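(* For every sufficiently large absolute constant $c_2$ there is a constant $c>0$ (depending only on $c_2$) such that the following holds. Let $\epsilon,\delta\in(0,1)$ and let $\mathbf A\in\mathbb R^{n\times n}$ be symmetric with $\|\mathbf A\|_\infty\le1$, eigenvalues $\lambda_1(\mathbf A)\ge\dots\ge\lambda_n(\mathbf A)$, no row that is identically zero, and $\mathrm{nnz}(\mathbf A)\ge\frac{c\log^8 n}{\epsilon^8\delta^4}$. Let $s>0$ and let $S\subseteq[n]$ be a random set formed by including each index $i$ independently with probability $p_i=\min\left(1,\frac{s\,\mathrm{nnz}(\mathbf A_i)}{\mathrm{nnz}(\mathbf A)}\right)$. Let $\tilde\lambda_1(\mathbf A),\dots,\tilde\lambda_n(\mathbf A)$ be the estimates computed from $\mathbf A_S$ by the sparsity-based procedure described in the context (with parameters $\epsilon$ and $c_2$). If $s\ge\frac{c\log^8 n}{\epsilon^8\delta^4}$, then with probability at least $1-\delta$, for all $i\in[n]$, $$|\tilde\lambda_i(\mathbf A)-\lambda_i(\mathbf A)|\le\epsilon\sqrt{\mathrm{nnz}(\mathbf A)}.$$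
   Context: $[n]=\{1,\dots,n\}$; $\|\mathbf A\|_\infty$ is the largest magnitude of an entry; $\mathbf A_i$ is the $i$-th row of $\mathbf A$; $\mathrm{nnz}(\cdot)$ is the number of nonzero entries. $\mathbf A_S$ denotes the principal submatrix indexed by $S$. Convention: $\log x$ is read as $\max\{1,\ln x\}$, and $\log^k n=(\log n)^k$. Sparsity-based procedure: given $S$, form the symmetric $|S|\times|S|$ matrix $\mathbf A'_S$ (rows and columns indexed by $i,j\in S$) with $$[\mathbf A'_S]_{i,j}=\begin{cases}0 & \text{if } i=j \text{ or } \mathrm{nnz}(\mathbf A_i)\,\mathrm{nnz}(\mathbf A_j)<\frac{\epsilon^2\,\mathrm{nnz}(\mathbf A)}{c_2\log^2 n},\\ \frac{1}{\sqrt{p_ip_j}}\mathbf A_{ij} & \text{otherwise.}\end{cases}$$ Let $\lambda_1(\mathbf A'_S)\ge\dots\ge\lambda_{|S|}(\mathbf A'_S)$ be its eigenvalues. For $i\in[|S|]$ with $\lambda_i(\mathbf A'_S)\ge0$ set $\tilde\lambda_i(\mathbf A)=\lambda_i(\mathbf A'_S)$; for $i\in[|S|]$ with $\lambda_i(\mathbf A'_S)<0$ set $\tilde\lambda_{n-(|S|-i)}(\mathbf A)=\lambda_i(\mathbf A'_S)$; for all remaining $i\in[n]$ set $\tilde\lambda_i(\mathbf A)=0$. *)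

theory Defs
  imports
    "HOL-Probability.Product_PMF"
    "Jordan_Normal_Form.Char_Poly"
    "Jordan_Normal_Form.DL_Submatrix"
begin

unbundle no vec_syntax

text \<open>
  Matrices are Jordan-Normal-Form matrices, so their rows and columns are numbered from \<open>0\<close>, and
  index sets are subsets of \<open>{..<n}\<close>. Eigenvalues and their estimates are numbered from \<open>1\<close>.
\<close>

text \<open>The convention that \<open>log x\<close> is read as \<open>max {1, ln x}\<close>.\<close>

definition trunc_ln :: "real \<Rightarrow> real" where
  "trunc_ln x = max 1 (ln x)"

definition nnz_vec :: "real Matrix.vec \<Rightarrow> nat" where
  "nnz_vec v = card {j. j < dim_vec v \<and> v $ j \<noteq> 0}"

definition nnz_mat :: "real mat \<Rightarrow> nat" where
  "nnz_mat A = card {(i, j). i < dim_row A \<and> j < dim_col A \<and> A $$ (i, j) \<noteq> 0}"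

text \<open>The element \<open>0\<close> only matters for the empty matrix.\<close>

definition max_norm_mat :: "real mat \<Rightarrow> real" where
  "max_norm_mat A = Max (insert 0 (abs ` elements_mat A))"

text \<open>
  \<open>eigval A i\<close> is the \<open>i\<close>-th largest eigenvalue, counted with multiplicity, for \<open>1 \<le> i \<le> n\<close>.
  It is meant for symmetric \<open>A\<close>, whose characteristic polynomial has \<open>n\<close> real roots.
\<close>

definition eigval :: "real mat \<Rightarrow> nat \<Rightarrow> real" where
  "eigval A i = rev (sorted_list_of_multiset (proots (char_poly A))) ! (i - 1)"

definition sample_prob :: "real \<Rightarrow> real mat \<Rightarrow> nat \<Rightarrow> real" where
  "sample_prob s A i = min 1 (s * real (nnz_vec (Matrix.row A i)) / real (nnz_mat A))"

definition random_subset :: "nat \<Rightarrow> (nat \<Rightarrow> real) \<Rightarrow> nat set pmf" where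
  "random_subset n p =
     map_pmf (\<lambda>X. {i\<in>{..<n}. X i}) (Pi_pmf {..<n} False (\<lambda>i. bernoulli_pmf (p i)))"

text \<open>
  The matrix \<open>A'\<^sub>S\<close>: position \<open>(a, b)\<close> belongs to the \<open>a\<close>-th and \<open>b\<close>-th smallest elements
  of \<open>S\<close>, as in \<^const>\<open>submatrix\<close>.
\<close>

definition sparsified_submatrix :: "real \<Rightarrow> real \<Rightarrow> real \<Rightarrow> real mat \<Rightarrow> nat set \<Rightarrow> real mat" where
  "sparsified_submatrix c2 \<epsilon> s A S =
     mat (card S) (card S) (\<lambda>(a, b).
       let i = pick S a; j = pick S b in
       if i = j \<or>
          real (nnz_vec (Matrix.row A i)) * real (nnz_vec (Matrix.row A j))
            < \<epsilon>\<^sup>2 * real (nnz_mat A) / (c2 * (trunc_ln (real (dim_row A)))\<^sup>2)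
       then 0
       else 1 / sqrt (sample_prob s A i * sample_prob s A j) * submatrix A S S $$ (a, b))"

text \<open>
  Read off at a target index \<open>j\<close>, the assignment to position \<open>n - (|S| - i)\<close> means
  \<open>i = j - (n - |S|)\<close>. The first two branches never both apply, since then the
  \<open>i\<close>-th eigenvalue would be negative and the \<open>j\<close>-th nonnegative, although \<open>i \<le> j\<close>.
\<close>

definition eigval_estimate :: "real \<Rightarrow> real \<Rightarrow> real \<Rightarrow> real mat \<Rightarrow> nat set \<Rightarrow> nat \<Rightarrow> real" where
  "eigval_estimate c2 \<epsilon> s A S j =
     (let n = dim_row A; k = card S; B = sparsified_submatrix c2 \<epsilon> s A S in
      if j \<in> {1..k} \<and> eigval B j \<ge> 0 then eigval B j
      else if j \<in> {n - k + 1..n} \<and> eigval B (j - (n - k)) < 0 then eigval B (j - (n - k))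
      else 0)"

end

theory Submission
  imports Defs
begin

text \<open>
  Let \<open>G\<close> be \<open>A\<close> with the diagonal and the light entries removed. A Schur test with weights
  \<open>sqrt (nnz (A\<^sub>i))\<close> shows that this perturbs every eigenvalue by at most
  \<open>\<epsilon> / 2 * sqrt (nnz A)\<close>. Let \<open>W\<close> be the diagonal matrix of inverse-probability
  weights (\<open>0\<close> off the sample), \<open>K = G W\<^sup>\<onehalf>\<close> and \<open>M = W\<^sup>\<onehalf> G W\<^sup>\<onehalf>\<close>, both restricted to the
  sample. Then \<open>K K\<^sup>T - G\<^sup>2\<close>, \<open>G K - K M\<close> and \<open>K\<^sup>T K - M\<^sup>2\<close> all come from \<open>G W G - G\<^sup>2\<close>, and since \<open>G\<close> has
  zero diagonal, the expected squares of their Frobenius norms are elementary second moments; Markov's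
  inequality bounds all three at once. So \<open>K\<close> approximately intertwines \<open>M\<close> and \<open>G\<close> while
  \<open>\<bar>K u\<bar> \<approx> \<bar>M u\<bar>\<close> and \<open>\<bar>K\<^sup>T x\<bar> \<approx> \<bar>G x\<bar>\<close>. Mapping the top eigenvectors of \<open>M\<close> by \<open>K\<close>, or those of \<open>G\<close> by
  \<open>K\<^sup>T\<close>, gives test spaces for the Courant-Fischer principle, so the eigenvalues of \<open>M\<close> and \<open>G\<close> that
  are large in absolute value agree up to a small error.
\<close>

unbundle no inner_syntax

section \<open>Real vectors\<close>

lemma scalar_prod_sum:
  assumes "y \<in> carrier_vec n"
  shows "x \<bullet> y = (\<Sum>i<n. x $ i * y $ i)"
  using assms by (auto simp: scalar_prod_def lessThan_atLeast0)

lemma scalar_prod_ge_0: "0 \<le> (x :: real vec) \<bullet> x"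
  by (auto simp: scalar_prod_def intro: sum_nonneg)

lemma scalar_prod_eq_0_iff:
  fixes x :: "real vec"
  assumes "x \<in> carrier_vec n"
  shows "x \<bullet> x = 0 \<longleftrightarrow> x = 0\<^sub>v n"
proof
  assume "x \<bullet> x = 0"
  then have "(\<Sum>i<n. x $ i * x $ i) = 0"
    using scalar_prod_sum[OF assms] by metis
  then have "\<forall>i<n. x $ i = 0"
    by (subst (asm) sum_nonneg_eq_0_iff) auto
  then show "x = 0\<^sub>v n"
    using assms by auto
qed (use assms in auto)

definition vnorm :: "real vec \<Rightarrow> real" where
  "vnorm x = sqrt (x \<bullet> x)"

lemma vnorm_ge_0: "0 \<le> vnorm x"
  by (simp add: vnorm_def scalar_prod_ge_0)

lemma vnorm_square: "(vnorm x)\<^sup>2 = x \<bullet> x"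
  by (simp add: vnorm_def scalar_prod_ge_0)

lemma vec_Cauchy_Schwarz:
  assumes "x \<in> carrier_vec n" "y \<in> carrier_vec n"
  shows "\<bar>x \<bullet> y\<bar> \<le> vnorm x * vnorm y"
proof -
  have "(x \<bullet> y)\<^sup>2 \<le> (x \<bullet> x) * (y \<bullet> y)"
    unfolding scalar_prod_sum[OF assms(1)] scalar_prod_sum[OF assms(2)]
    using Cauchy_Schwarz_ineq_sum[of "\<lambda>i. x $ i" "\<lambda>i. y $ i" "{..<n}"]
    by (simp add: power2_eq_square)
  then have "sqrt ((x \<bullet> y)\<^sup>2) \<le> sqrt ((x \<bullet> x) * (y \<bullet> y))"
    by (rule real_sqrt_le_mono)
  then show ?thesis
    by (simp add: vnorm_def real_sqrt_mult)
qed

section \<open>Frobenius norm as a bound for the operator norm\<close>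

definition frobenius_sq :: "real mat \<Rightarrow> real" where
  "frobenius_sq X = (\<Sum>i<dim_row X. \<Sum>j<dim_col X. (X $$ (i, j))\<^sup>2)"

lemma frobenius_sq_transpose: "frobenius_sq (X\<^sup>T) = frobenius_sq X"
proof -
  have "frobenius_sq (X\<^sup>T) = (\<Sum>i<dim_col X. \<Sum>j<dim_row X. (X $$ (j, i))\<^sup>2)"
    by (simp add: frobenius_sq_def)
  also have "\<dots> = frobenius_sq X"
    unfolding frobenius_sq_def by (rule sum.swap)
  finally show ?thesis .
qed

lemma frobenius_sq_uminus: "frobenius_sq (- X) = frobenius_sq X"
  by (simp add: frobenius_sq_def)

text \<open>Cauchy-Schwarz in each row. The error matrices are controlled through the expectation of
  \<open>frobenius_sq\<close>, while the spectral argument needs their action on vectors.\<close>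

lemma vnorm_mult_mat_vec_le:
  assumes X: "X \<in> carrier_mat n m" and u: "u \<in> carrier_vec m"
    and fro: "frobenius_sq X \<le> \<beta>\<^sup>2" and "0 \<le> \<beta>"
  shows "vnorm (X *\<^sub>v u) \<le> \<beta> * vnorm u"
proof -
  have "(X *\<^sub>v u) \<bullet> (X *\<^sub>v u) = (\<Sum>i<n. (\<Sum>j<m. X $$ (i, j) * u $ j)\<^sup>2)"
    using X u by (subst scalar_prod_sum[of _ n])
      (auto simp: power2_eq_square scalar_prod_sum[OF u] intro!: sum.cong)
  also have "\<dots> \<le> (\<Sum>i<n. (\<Sum>j<m. (X $$ (i, j))\<^sup>2) * (\<Sum>j<m. (u $ j)\<^sup>2))"
    by (intro sum_mono Cauchy_Schwarz_ineq_sum)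
  also have "\<dots> = frobenius_sq X * (u \<bullet> u)"
    using X by (simp add: frobenius_sq_def sum_distrib_right[symmetric] scalar_prod_sum[OF u]
        power2_eq_square)
  also have "\<dots> \<le> \<beta>\<^sup>2 * (u \<bullet> u)"
    by (intro mult_right_mono fro scalar_prod_ge_0)
  finally have "sqrt ((X *\<^sub>v u) \<bullet> (X *\<^sub>v u)) \<le> sqrt (\<beta>\<^sup>2 * (u \<bullet> u))"
    by (rule real_sqrt_le_mono)
  then show ?thesis
    using \<open>0 \<le> \<beta>\<close> by (simp add: vnorm_def real_sqrt_mult)
qed

section \<open>The spectral theorem for real symmetric matrices\<close>

text \<open>The characteristic polynomial has a complex root \<open>a + i b\<close> with eigenvector
  \<open>u + i v\<close>. Comparing \<open>A u . v\<close> with \<open>u . A v\<close> gives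
  \<open>b * (u . u + v . v) = 0\<close>, so \<open>b = 0\<close>, and whichever of \<open>u\<close>
  and \<open>v\<close> is nonzero is a real eigenvector.\<close>

lemma symmetric_mat_unit_eigenvector:
  fixes A :: "real mat"
  assumes A: "A \<in> carrier_mat n n" and sym: "A\<^sup>T = A" and n: "0 < n"
  obtains e v where "v \<in> carrier_vec n" "v \<bullet> v = 1" "A *\<^sub>v v = e \<cdot>\<^sub>v v"
proof -
  define C :: "complex mat" where "C = map_mat of_real A"
  have C: "C \<in> carrier_mat n n"
    using A by (simp add: C_def)
  obtain as where as: "char_poly C = (\<Prod>a\<leftarrow>as. [:- a, 1:])" "length as = n"
    using char_poly_factorized[OF C] by blast
  then obtain z zs where "as = z # zs"
    using n by (cases as) auto
  then have "poly (char_poly C) z = 0"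
    using as by simp
  then obtain w where w: "w \<in> carrier_vec n" "w \<noteq> 0\<^sub>v n" "C *\<^sub>v w = z \<cdot>\<^sub>v w"
    using eigenvalue_root_char_poly[OF C] C by (auto simp: eigenvalue_def eigenvector_def)
  define a b where "a = Re z" and "b = Im z"
  define u where "u = map_vec Re w"
  define v where "v = map_vec Im w"
  have u: "u \<in> carrier_vec n" and v: "v \<in> carrier_vec n"
    using w by (auto simp: u_def v_def)
  have Cw: "(\<Sum>j<n. of_real (A $$ (i, j)) * w $ j) = z * w $ i" if "i < n" for i
  proof -
    have "(C *\<^sub>v w) $ i = (z \<cdot>\<^sub>v w) $ i"
      using w by simp
    then show ?thesis
      using that A w(1) C by (simp add: C_def scalar_prod_sum[OF w(1)])
  qed
  have Au: "A *\<^sub>v u = a \<cdot>\<^sub>v u - b \<cdot>\<^sub>v v"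
  proof (rule eq_vecI)
    fix i assume "i < dim_vec (a \<cdot>\<^sub>v u - b \<cdot>\<^sub>v v)"
    then have i: "i < n" using v by simp
    have "(A *\<^sub>v u) $ i = (\<Sum>j<n. A $$ (i, j) * Re (w $ j))"
      using i A w(1) by (simp add: scalar_prod_sum[OF u]) (simp add: u_def)
    also have "\<dots> = Re (z * w $ i)"
      unfolding Cw[OF i, symmetric] by simp
    finally show "(A *\<^sub>v u) $ i = (a \<cdot>\<^sub>v u - b \<cdot>\<^sub>v v) $ i"
      using i w(1) by (simp add: a_def b_def u_def v_def)
  qed (use A v in auto)
  have Av: "A *\<^sub>v v = b \<cdot>\<^sub>v u + a \<cdot>\<^sub>v v"
  proof (rule eq_vecI)
    fix i assume "i < dim_vec (b \<cdot>\<^sub>v u + a \<cdot>\<^sub>v v)"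
    then have i: "i < n" using v by simp
    have "(A *\<^sub>v v) $ i = (\<Sum>j<n. A $$ (i, j) * Im (w $ j))"
      using i A w(1) by (simp add: scalar_prod_sum[OF v]) (simp add: v_def)
    also have "\<dots> = Im (z * w $ i)"
      unfolding Cw[OF i, symmetric] by simp
    finally show "(A *\<^sub>v v) $ i = (b \<cdot>\<^sub>v u + a \<cdot>\<^sub>v v) $ i"
      using i w(1) by (simp add: a_def b_def u_def v_def)
  qed (use A v in auto)
  have "(A *\<^sub>v u) \<bullet> v = u \<bullet> (A *\<^sub>v v)"
    using transpose_vec_mult_scalar[OF A v u] sym by simp
  then have "a * (u \<bullet> v) - b * (v \<bullet> v) = b * (u \<bullet> u) + a * (u \<bullet> v)"
    using u v unfolding Au Av
    by (simp add: minus_scalar_prod_distrib[of _ n] scalar_prod_add_distrib[of _ n])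
  then have b_eq: "b * (u \<bullet> u + v \<bullet> v) = 0"
    by (simp add: algebra_simps)
  have "u \<bullet> u \<noteq> 0 \<or> v \<bullet> v \<noteq> 0"
  proof (rule ccontr)
    assume "\<not> ?thesis"
    then have "u = 0\<^sub>v n" "v = 0\<^sub>v n"
      using scalar_prod_eq_0_iff u v by auto
    then have "w $ i = 0" if "i < n" for i
      using that w(1) unfolding u_def v_def
      by (metis (no_types, lifting) carrier_vecD complex_eqI index_map_vec(1) index_zero_vec(1)
          zero_complex.simps)
    then show False
      using w by auto
  qed
  then have "u \<bullet> u + v \<bullet> v \<noteq> 0"
    using scalar_prod_ge_0[of u] scalar_prod_ge_0[of v] by linarith
  then have "b = 0"
    using b_eq by simp
  note result = that
  have main: thesis if x: "x \<in> carrier_vec n" "x \<bullet> x \<noteq> 0" "A *\<^sub>v x = a \<cdot>\<^sub>v x" for x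
  proof (rule result[of "(1 / vnorm x) \<cdot>\<^sub>v x" a])
    have "0 < vnorm x"
      using x(2) scalar_prod_ge_0[of x] by (simp add: vnorm_def)
    then show "((1 / vnorm x) \<cdot>\<^sub>v x) \<bullet> ((1 / vnorm x) \<cdot>\<^sub>v x) = 1"
      using x(1,2) vnorm_square[of x] by (simp add: power2_eq_square)
    show "A *\<^sub>v ((1 / vnorm x) \<cdot>\<^sub>v x) = a \<cdot>\<^sub>v ((1 / vnorm x) \<cdot>\<^sub>v x)"
      using mult_mat_vec[OF A x(1)] x(3) by (simp add: smult_smult_assoc mult.commute)
  qed (use x in auto)
  from \<open>u \<bullet> u \<noteq> 0 \<or> v \<bullet> v \<noteq> 0\<close> show thesis
  proof
    assume "u \<bullet> u \<noteq> 0"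
    moreover have "A *\<^sub>v u = a \<cdot>\<^sub>v u"
      using u v Au \<open>b = 0\<close> by auto
    ultimately show thesis
      using main u by blast
  next
    assume "v \<bullet> v \<noteq> 0"
    moreover have "A *\<^sub>v v = a \<cdot>\<^sub>v v"
      using u v Av \<open>b = 0\<close> by auto
    ultimately show thesis
      using main v by blast
  qed
qed

text \<open>The reflection \<open>I - 2 w w^T / (w . w)\<close> with \<open>w = v - e_0\<close>
  swaps \<open>v\<close> and \<open>e_0\<close>. It degenerates for \<open>v = e_0\<close>, where
  the identity serves instead.\<close>

lemma unit_vec_Householder:
  fixes v :: "real vec"
  assumes v: "v \<in> carrier_vec n" "v \<bullet> v = 1" and n: "0 < n"
  obtains W where "W \<in> carrier_mat n n" "W\<^sup>T = W" "W * W = 1\<^sub>m n" "W *\<^sub>v unit_vec n 0 = v"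
proof (cases "v = unit_vec n 0")
  case True
  show thesis
    by (rule that[of "1\<^sub>m n"]) (use True in auto)
next
  case False
  define w where "w = v - unit_vec n 0"
  have w: "w \<in> carrier_vec n"
    using v by (simp add: w_def)
  define q where "q = w \<bullet> w"
  have q: "q = 2 - 2 * v $ 0"
  proof -
    have "q = v \<bullet> v - v \<bullet> unit_vec n 0 - (unit_vec n 0 \<bullet> v - unit_vec n 0 \<bullet> unit_vec n 0)"
      using v by (simp add: q_def w_def minus_scalar_prod_distrib[of _ n]
          scalar_prod_minus_distrib[of _ n])
    then show ?thesis
      using v n by simp
  qed
  have q0: "q \<noteq> 0"
  proof
    assume "q = 0"
    then have w0: "w = 0\<^sub>v n"
      using scalar_prod_eq_0_iff[OF w] by (simp add: q_def)
    have "v = unit_vec n 0"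
    proof (rule eq_vecI)
      fix i assume "i < dim_vec (unit_vec n 0 :: real vec)"
      then have "(v - unit_vec n 0) $ i = 0"
        using w0 v unfolding w_def by simp
      then show "v $ i = unit_vec n 0 $ i"
        using \<open>i < dim_vec (unit_vec n 0 :: real vec)\<close> v by simp
    qed (use v in auto)
    with False show False by simp
  qed
  define W where "W = mat n n (\<lambda>(i, j). (if i = j then 1 else 0) - 2 * w $ i * w $ j / q)"
  have W: "W \<in> carrier_mat n n"
    by (simp add: W_def)
  have sum_w: "(\<Sum>k<n. w $ k * w $ k) = q"
    by (simp add: q_def scalar_prod_sum[OF w])
  show thesis
  proof (rule that[OF W])
    show "W\<^sup>T = W"
      by (rule eq_matI) (auto simp: W_def)
    show "W * W = 1\<^sub>m n"
    proof (rule eq_matI)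
      fix i j assume "i < dim_row (1\<^sub>m n :: real mat)" "j < dim_col (1\<^sub>m n :: real mat)"
      then have ij: "i < n" "j < n" by auto
      have "(W * W) $$ (i, j) = (\<Sum>k<n. W $$ (i, k) * W $$ (k, j))"
        using ij W by (simp add: scalar_prod_def lessThan_atLeast0)
      also have "\<dots> = (\<Sum>k<n. (if i = k then if k = j then 1 else 0 else 0)
          - (if k = i then 2 * w $ i * w $ j / q else 0) - (if k = j then 2 * w $ i * w $ j / q else 0)
          + 4 * w $ i * w $ j / q\<^sup>2 * (w $ k * w $ k))"
        using ij by (intro sum.cong) (auto simp: W_def power2_eq_square algebra_simps)
      also have "\<dots> = (if i = j then 1 else 0) - 4 * w $ i * w $ j / q
          + 4 * w $ i * w $ j / q\<^sup>2 * q"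
        using ij unfolding sum.distrib sum_subtractf sum_distrib_left[symmetric] sum_w by simp
      also have "\<dots> = (if i = j then 1 else 0)"
        using q0 by (simp add: power2_eq_square)
      finally show "(W * W) $$ (i, j) = 1\<^sub>m n $$ (i, j)"
        using ij by simp
    qed (use W in auto)
    show "W *\<^sub>v unit_vec n 0 = v"
    proof (rule eq_vecI)
      fix i assume "i < dim_vec v"
      then have i: "i < n" using v by simp
      \<comment> \<open>As \<open>v\<close> is a unit vector, \<open>q = 2 - 2 * v $ 0\<close>;
        hence the factor \<open>- 2 * w $ 0 / q\<close> is 1 and column 0 of \<open>W\<close> is
        \<open>e_0 + w = v\<close>.\<close>
      have w0: "w $ 0 = - q / 2"
        using n v q by (simp add: w_def field_simps)
      have "(W *\<^sub>v unit_vec n 0) $ i = W $$ (i, 0)"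
        using i n W by simp
      also have "\<dots> = (if i = 0 then 1 else 0) + w $ i"
        using i n q0 by (simp add: W_def w0)
      also have "\<dots> = v $ i"
        using i v n by (simp add: w_def)
      finally show "(W *\<^sub>v unit_vec n 0) $ i = v $ i" .
    qed (use W v in auto)
  qed
qed

text \<open>The diagonal \<open>f\<close> comes in no particular order;
  \<open>symmetric_mat_eigval_diagonalization\<close> sorts it.\<close>

definition orthogonal_diagonalization :: "nat \<Rightarrow> real mat \<Rightarrow> real mat \<Rightarrow> (nat \<Rightarrow> real) \<Rightarrow> bool" where
  "orthogonal_diagonalization n A Q f \<longleftrightarrow>
     Q \<in> carrier_mat n n \<and> Q\<^sup>T * Q = 1\<^sub>m n \<and> Q * Q\<^sup>T = 1\<^sub>m n \<and> A = Q * mat_diag n f * Q\<^sup>T"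

lemma orthogonal_diagonalization_similar:
  assumes "orthogonal_diagonalization n A Q f"
  shows "similar_mat A (mat_diag n f)"
  using assms unfolding similar_mat_def similar_mat_wit_def orthogonal_diagonalization_def Let_def
  by (intro exI[of _ Q] exI[of _ "Q\<^sup>T"]) auto

lemma orthogonal_diagonalization_conjugate:
  assumes W: "W \<in> carrier_mat n n" "W\<^sup>T = W" "W * W = 1\<^sub>m n"
    and A: "A \<in> carrier_mat n n"
    and dg: "orthogonal_diagonalization n (W * A * W) Q f"
  shows "orthogonal_diagonalization n A (W * Q) f"
proof -
  have Q: "Q \<in> carrier_mat n n" "Q\<^sup>T * Q = 1\<^sub>m n" "Q * Q\<^sup>T = 1\<^sub>m n"
    and eq: "W * A * W = Q * mat_diag n f * Q\<^sup>T"
    using dg unfolding orthogonal_diagonalization_def by auto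
  define D where "D = mat_diag n f"
  have D: "D \<in> carrier_mat n n" by (simp add: D_def)
  have tr: "(W * Q)\<^sup>T = Q\<^sup>T * W"
    using transpose_mult[OF W(1) Q(1)] W(2) by simp
  have "(Q\<^sup>T * W) * (W * Q) = Q\<^sup>T * (W * W) * Q"
    using W(1) Q(1) by (simp add: assoc_mult_mat[of _ n n _ n _ n])
  then have 1: "(Q\<^sup>T * W) * (W * Q) = 1\<^sub>m n"
    using W Q by simp
  have "(W * Q) * (Q\<^sup>T * W) = W * (Q * Q\<^sup>T) * W"
    using W(1) Q(1) by (simp add: assoc_mult_mat[of _ n n _ n _ n])
  then have 2: "(W * Q) * (Q\<^sup>T * W) = 1\<^sub>m n"
    using W Q by simp
  have "(W * Q) * D * (Q\<^sup>T * W) = W * (Q * D * Q\<^sup>T) * W"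
    using W(1) Q(1) D by (simp add: assoc_mult_mat[of _ n n _ n _ n])
  also have "\<dots> = (W * W) * A * (W * W)"
    unfolding D_def eq[symmetric] using W(1) A by (simp add: assoc_mult_mat[of _ n n _ n _ n])
  also have "\<dots> = A"
    using W A by simp
  finally show ?thesis
    using 1 2 W Q unfolding orthogonal_diagonalization_def tr D_def by auto
qed

lemma orthogonal_diagonalization_four_block:
  assumes dg: "orthogonal_diagonalization m A Q f"
  shows "orthogonal_diagonalization (Suc m) (four_block_mat (mat 1 1 (\<lambda>_. e)) (0\<^sub>m 1 m) (0\<^sub>m m 1) A)
    (four_block_mat (1\<^sub>m 1) (0\<^sub>m 1 m) (0\<^sub>m m 1) Q) (case_nat e f)"
proof -
  have Q: "Q \<in> carrier_mat m m" "Q\<^sup>T * Q = 1\<^sub>m m" "Q * Q\<^sup>T = 1\<^sub>m m"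
    and A: "A = Q * mat_diag m f * Q\<^sup>T"
    using dg unfolding orthogonal_diagonalization_def by auto
  have E: "mat 1 1 (\<lambda>_. e) \<in> carrier_mat 1 1" by simp
  define D where "D = mat_diag m f"
  have D: "D \<in> carrier_mat m m" by (simp add: D_def)
  define P where "P = four_block_mat (1\<^sub>m 1) (0\<^sub>m 1 m) (0\<^sub>m m 1) Q"
  have P: "P \<in> carrier_mat (Suc m) (Suc m)"
    using four_block_carrier_mat[of "1\<^sub>m 1" 1 1 Q m m] Q unfolding P_def by simp
  have PT: "P\<^sup>T = four_block_mat (1\<^sub>m 1) (0\<^sub>m 1 m) (0\<^sub>m m 1) Q\<^sup>T"
    unfolding P_def using Q by (subst transpose_four_block_mat[of _ 1 1 _ m _ m]) auto
  have diag: "mat_diag (Suc m) (case_nat e f)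
      = four_block_mat (mat 1 1 (\<lambda>_. e)) (0\<^sub>m 1 m) (0\<^sub>m m 1) (mat_diag m f)"
    by (rule eq_matI) (auto simp: mat_diag_def split: nat.splits)
  have one: "four_block_mat (1\<^sub>m 1) (0\<^sub>m 1 m) (0\<^sub>m m 1) (1\<^sub>m m) = 1\<^sub>m (Suc m)"
    by simp
  have "P\<^sup>T * P = 1\<^sub>m (Suc m)"
    unfolding PT unfolding P_def using Q one
    by (subst mult_four_block_mat[of _ 1 1 _ m _ m _ _ 1 _ m]) auto
  moreover have "P * P\<^sup>T = 1\<^sub>m (Suc m)"
    unfolding PT unfolding P_def using Q one
    by (subst mult_four_block_mat[of _ 1 1 _ m _ m _ _ 1 _ m]) auto
  moreover have "P * mat_diag (Suc m) (case_nat e f)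
      = four_block_mat (mat 1 1 (\<lambda>_. e)) (0\<^sub>m 1 m) (0\<^sub>m m 1) (Q * D)"
    unfolding diag P_def D_def[symmetric] using Q D E
    by (subst mult_four_block_mat[of _ 1 1 _ m _ m _ _ 1 _ m]) auto
  then have "P * mat_diag (Suc m) (case_nat e f) * P\<^sup>T
      = four_block_mat (mat 1 1 (\<lambda>_. e)) (0\<^sub>m 1 m) (0\<^sub>m m 1) A"
    unfolding PT A D_def[symmetric] using Q D E mult_carrier_mat[OF Q(1) D]
    by (simp, subst mult_four_block_mat[of _ 1 1 _ m _ m _ _ 1 _ m]) auto
  ultimately show ?thesis
    unfolding orthogonal_diagonalization_def P_def[symmetric] using P by simp
qed

text \<open>Deflation by induction on the dimension: a Householder reflection moves a unit
  eigenvector to \<open>e_0\<close>. The first column of \<open>W A W\<close> then vanishes below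
  the corner, by symmetry so does the first row, and the remaining block is symmetric of size
  \<open>m\<close>.\<close>

lemma symmetric_mat_orthogonal_diagonalization:
  assumes "A \<in> carrier_mat n n" "A\<^sup>T = A"
  shows "\<exists>Q f. orthogonal_diagonalization n A Q f"
  using assms
proof (induction n arbitrary: A)
  case 0
  then show ?case
    by (intro exI[of _ "1\<^sub>m 0"] exI[of _ "\<lambda>_. 0"])
      (auto simp: orthogonal_diagonalization_def intro: eq_matI)
next
  case (Suc m)
  let ?n = "Suc m"
  note A = Suc.prems
  obtain e v where v: "v \<in> carrier_vec ?n" "v \<bullet> v = 1" "A *\<^sub>v v = e \<cdot>\<^sub>v v"
    using symmetric_mat_unit_eigenvector[OF A] by blast
  obtain W where W: "W \<in> carrier_mat ?n ?n" "W\<^sup>T = W" "W * W = 1\<^sub>m ?n" "W *\<^sub>v unit_vec ?n 0 = v"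
    using unit_vec_Householder[OF v(1,2)] by auto
  define B where "B = W * A * W"
  have B: "B \<in> carrier_mat ?n ?n"
    using W A by (simp add: B_def)
  have Bsym: "B\<^sup>T = B"
    unfolding B_def using W A
    by (simp add: transpose_mult[of _ ?n ?n _ ?n] assoc_mult_mat[of _ ?n ?n _ ?n _ ?n])
  have Wv: "W *\<^sub>v v = unit_vec ?n 0"
    using assoc_mult_mat_vec[OF W(1) W(1), of "unit_vec ?n 0"] W by simp
  have Be: "B *\<^sub>v unit_vec ?n 0 = e \<cdot>\<^sub>v unit_vec ?n 0"
    unfolding B_def using W A v Wv
    by (simp add: assoc_mult_mat_vec[of _ ?n ?n _ ?n] mult_mat_vec[of _ ?n ?n])
  have col0: "B $$ (i, 0) = (if i = 0 then e else 0)" if "i < ?n" for i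
  proof -
    have "B $$ (i, 0) = (B *\<^sub>v unit_vec ?n 0) $ i"
      using that B by simp
    then show ?thesis
      using that by (simp add: Be)
  qed
  have row0: "B $$ (0, i) = (if i = 0 then e else 0)" if "i < ?n" for i
    using col0[OF that] that B arg_cong[OF Bsym, of "\<lambda>M. M $$ (0, i)"] by auto
  define A3 where "A3 = mat m m (\<lambda>(i, j). B $$ (Suc i, Suc j))"
  have A3: "A3 \<in> carrier_mat m m"
    by (simp add: A3_def)
  have "A3\<^sup>T = A3"
  proof (rule eq_matI)
    fix i j assume "i < dim_row A3" "j < dim_col A3"
    then show "A3\<^sup>T $$ (i, j) = A3 $$ (i, j)"
      using B arg_cong[OF Bsym, of "\<lambda>M. M $$ (Suc i, Suc j)"] by (auto simp: A3_def)
  qed (use A3 in auto)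
  then obtain Q f where dg: "orthogonal_diagonalization m A3 Q f"
    using Suc.IH[OF A3] by blast
  have "B = four_block_mat (mat 1 1 (\<lambda>_. e)) (0\<^sub>m 1 m) (0\<^sub>m m 1) A3"
  proof (rule eq_matI)
    fix i j assume "i < dim_row (four_block_mat (mat 1 1 (\<lambda>_. e)) (0\<^sub>m 1 m) (0\<^sub>m m 1) A3)"
      "j < dim_col (four_block_mat (mat 1 1 (\<lambda>_. e)) (0\<^sub>m 1 m) (0\<^sub>m m 1) A3)"
    then show "B $$ (i, j) = four_block_mat (mat 1 1 (\<lambda>_. e)) (0\<^sub>m 1 m) (0\<^sub>m m 1) A3 $$ (i, j)"
      using A3 by (auto simp: col0 row0) (auto simp: A3_def)
  qed (use A3 B in auto)
  then show ?case
    using orthogonal_diagonalization_conjugate[OF W(1-3) A(1)]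
      orthogonal_diagonalization_four_block[OF dg, of e] unfolding B_def by metis
qed

section \<open>Ordered eigenvalues\<close>

lemma proots_char_poly_diagonalization:
  assumes "orthogonal_diagonalization n A Q f"
  shows "proots (char_poly A) = mset (map f [0..<n])"
proof -
  have "char_poly A = char_poly (mat_diag n f)"
    by (rule char_poly_similar[OF orthogonal_diagonalization_similar[OF assms]])
  also have "\<dots> = (\<Prod>a\<leftarrow>diag_mat (mat_diag n f). [:- a, 1:])"
    by (rule char_poly_upper_triangular[of _ n]) (auto simp: mat_diag_def)
  also have "diag_mat (mat_diag n f) = map f [0..<n]"
    by (auto simp: diag_mat_def mat_diag_def intro!: nth_equalityI)
  finally have "char_poly A = (\<Prod>a\<leftarrow>map f [0..<n]. [:- a, 1:])" .
  moreover have "proots (\<Prod>a\<leftarrow>xs. [:- a, 1:]) = mset xs" for xs :: "real list"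
  proof (induction xs)
    case (Cons a xs)
    have "(\<Prod>a\<leftarrow>xs. [:- a, 1:]) \<noteq> 0"
      by (auto simp: prod_list_zero_iff)
    then show ?case
      using Cons.IH by (simp add: proots_mult del: mult_pCons_left)
  qed simp
  ultimately show ?thesis by metis
qed

lemma size_proots_char_poly:
  fixes A :: "real mat"
  assumes "A \<in> carrier_mat n n" "A\<^sup>T = A"
  shows "size (proots (char_poly A)) = n"
  using symmetric_mat_orthogonal_diagonalization[OF assms] proots_char_poly_diagonalization
  by fastforce

lemma eigval_antimono:
  fixes A :: "real mat"
  assumes A: "A \<in> carrier_mat n n" "A\<^sup>T = A" and "1 \<le> i" "i \<le> j" "j \<le> n"
  shows "eigval A j \<le> eigval A i"
proof -
  define xs where "xs = sorted_list_of_multiset (proots (char_poly A))"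
  have len: "length xs = n"
    using size_proots_char_poly[OF A] unfolding xs_def
    by (metis mset_sorted_list_of_multiset size_mset)
  have "sorted xs" by (simp add: xs_def)
  \<comment> \<open>Reversing the ascending list makes \<open>eigval A i\<close> its entry at
    position \<open>n - i\<close>.\<close>
  then have "xs ! (n - j) \<le> xs ! (n - i)"
    using assms len by (intro sorted_nth_mono) auto
  then show ?thesis
    using assms(3-5) len unfolding eigval_def xs_def[symmetric] by (simp add: rev_nth)
qed

text \<open>Negating and reversing a sorted list sorts it again. This transfers statements about the
  top of the spectrum to the bottom.\<close>

lemma eigval_uminus:
  fixes A :: "real mat"
  assumes A: "A \<in> carrier_mat n n" "A\<^sup>T = A" and i: "1 \<le> i" "i \<le> n"
  shows "eigval (- A) i = - eigval A (n + 1 - i)"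
proof -
  define xs where "xs = sorted_list_of_multiset (proots (char_poly A))"
  have len: "length xs = n"
    using size_proots_char_poly[OF A] unfolding xs_def
    by (metis mset_sorted_list_of_multiset size_mset)
  obtain Q f where dg: "orthogonal_diagonalization n A Q f"
    using symmetric_mat_orthogonal_diagonalization[OF A] by blast
  then have Q: "Q \<in> carrier_mat n n" and eq: "A = Q * mat_diag n f * Q\<^sup>T"
    unfolding orthogonal_diagonalization_def by auto
  have Dm: "mat_diag n (\<lambda>i. - f i) = - mat_diag n f"
    by (rule eq_matI) (auto simp: mat_diag_def)
  have "Q * (- D) * Q\<^sup>T = - (Q * D * Q\<^sup>T)" if "D \<in> carrier_mat n n" for D
    using Q that by simp
  then have "Q * (- mat_diag n f) * Q\<^sup>T = - A"
    unfolding eq by simp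
  then have "orthogonal_diagonalization n (- A) Q (\<lambda>i. - f i)"
    using dg unfolding orthogonal_diagonalization_def Dm by auto
  then have "proots (char_poly (- A)) = image_mset uminus (proots (char_poly A))"
    using proots_char_poly_diagonalization[OF dg] proots_char_poly_diagonalization[of n "- A"]
    by (auto simp: multiset.map_comp comp_def)
  also have "\<dots> = mset (rev (map uminus xs))"
    unfolding xs_def by simp
  finally have eqm: "sorted_list_of_multiset (proots (char_poly (- A)))
      = sorted_list_of_multiset (mset (rev (map uminus xs)))" by simp
  have "sorted xs" by (simp add: xs_def)
  then have "sorted (rev (map uminus xs))"
    by (simp add: rev_map sorted_map sorted_wrt_rev sorted_wrt_map)
  then have "sorted_list_of_multiset (proots (char_poly (- A))) = rev (map uminus xs)"
    unfolding eqm sorted_list_of_multiset_mset by (rule sorted_sort_id)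
  then show ?thesis
    using i len unfolding eigval_def xs_def[symmetric] by (simp add: rev_nth)
qed

text \<open>The diagonal of any diagonalization and the sorted root list are the same multiset, so
  some permutation relates them; permuting the columns of \<open>Q\<close> by it keeps
  \<open>Q\<close> orthogonal.\<close>

lemma symmetric_mat_eigval_diagonalization:
  fixes A :: "real mat"
  assumes A: "A \<in> carrier_mat n n" "A\<^sup>T = A"
  obtains Q where "Q \<in> carrier_mat n n" "Q\<^sup>T * Q = 1\<^sub>m n" "Q * Q\<^sup>T = 1\<^sub>m n"
    "A * Q = Q * mat_diag n (\<lambda>i. eigval A (Suc i))"
proof -
  obtain Q f where dg: "orthogonal_diagonalization n A Q f"
    using symmetric_mat_orthogonal_diagonalization[OF A] by blast
  then have Q: "Q \<in> carrier_mat n n" "Q\<^sup>T * Q = 1\<^sub>m n" "Q * Q\<^sup>T = 1\<^sub>m n"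
    and eq: "A = Q * mat_diag n f * Q\<^sup>T"
    unfolding orthogonal_diagonalization_def by auto
  have AQ: "A * Q = Q * mat_diag n f"
  proof -
    have "Q * D * Q\<^sup>T * Q = Q * D * (Q\<^sup>T * Q)" if "D \<in> carrier_mat n n" for D
      using Q(1) that by (simp add: assoc_mult_mat[of _ n n _ n _ n])
    then have "A * Q = Q * mat_diag n f * (Q\<^sup>T * Q)"
      unfolding eq by simp
    then show ?thesis
      using Q right_mult_one_mat[OF mult_carrier_mat[OF Q(1) mat_diag_dim]] by simp
  qed
  define xs where "xs = rev (sorted_list_of_multiset (proots (char_poly A)))"
  have "mset xs = mset (map f [0..<n])"
    using proots_char_poly_diagonalization[OF dg] by (simp add: xs_def)
  then obtain p where p: "p permutes {..<length (map f [0..<n])}" "permute_list p (map f [0..<n]) = xs"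
    using mset_eq_permutation by metis
  then have pn: "p permutes {..<n}" by simp
  have eig: "eigval A (Suc i) = f (p i)" if "i < n" for i
  proof -
    have "p i < n" using that permutes_in_image[OF pn, of i] by simp
    then show ?thesis
      using that p(2) permute_list_nth[OF p(1), of i] unfolding eigval_def xs_def[symmetric]
      by simp
  qed
  define Q' where "Q' = mat n n (\<lambda>(i, j). Q $$ (i, p j))"
  have Q': "Q' \<in> carrier_mat n n" by (simp add: Q'_def)
  have lt: "p i < n" if "i < n" for i
    using that permutes_in_image[OF pn, of i] by simp
  have QTQ: "Q'\<^sup>T * Q' = 1\<^sub>m n"
  proof (rule eq_matI)
    fix i j assume "i < dim_row (1\<^sub>m n :: real mat)" "j < dim_col (1\<^sub>m n :: real mat)"
    then have ij: "i < n" "j < n" by auto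
    have "(Q'\<^sup>T * Q') $$ (i, j) = (Q\<^sup>T * Q) $$ (p i, p j)"
      using ij lt Q(1) by (simp add: Q'_def scalar_prod_def)
    also have "\<dots> = 1\<^sub>m n $$ (i, j)"
      using ij lt Q(2) permutes_inj[OF pn] by (simp add: inj_eq)
    finally show "(Q'\<^sup>T * Q') $$ (i, j) = 1\<^sub>m n $$ (i, j)" .
  qed (use Q' in auto)
  show thesis
  proof (rule that[OF Q' QTQ])
    show "Q' * Q'\<^sup>T = 1\<^sub>m n"
      using mat_mult_left_right_inverse[OF _ Q' QTQ] Q' by simp
    show "A * Q' = Q' * mat_diag n (\<lambda>i. eigval A (Suc i))"
    proof (rule eq_matI)
      fix i j assume "i < dim_row (Q' * mat_diag n (\<lambda>i. eigval A (Suc i)))"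
        "j < dim_col (Q' * mat_diag n (\<lambda>i. eigval A (Suc i)))"
      then have ij: "i < n" "j < n" using Q' by (auto simp: mat_diag_def)
      have "(A * Q') $$ (i, j) = (A * Q) $$ (i, p j)"
        using ij lt Q(1) A(1) by (simp add: Q'_def scalar_prod_def)
      also have "\<dots> = Q $$ (i, p j) * f (p j)"
        unfolding AQ using ij lt Q(1) by (simp add: mat_diag_mult_right[of _ n])
      also have "\<dots> = (Q' * mat_diag n (\<lambda>i. eigval A (Suc i))) $$ (i, j)"
        using ij Q' eig by (simp add: mat_diag_mult_right[of _ n] Q'_def)
      finally show "(A * Q') $$ (i, j) = (Q' * mat_diag n (\<lambda>i. eigval A (Suc i))) $$ (i, j)" .
    qed (use A Q' in \<open>auto simp: mat_diag_def\<close>)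
  qed
qed

section \<open>Courant-Fischer test spaces and Weyl's perturbation inequality\<close>

lemma underdetermined_system_solution:
  fixes M :: "real mat"
  assumes M: "M \<in> carrier_mat r k" and "r < k"
  obtains c where "c \<in> carrier_vec k" "c \<noteq> 0\<^sub>v k" "\<And>i. i < r \<Longrightarrow> (M *\<^sub>v c) $ i = 0"
proof -
  define N where "N = mat k k (\<lambda>(i, j). if i < r then M $$ (i, j) else 0)"
  have N: "N \<in> carrier_mat k k" by (simp add: N_def)
  \<comment> \<open>Padding with zero rows makes the system square. Row \<open>r\<close> of
    \<open>N\<close> is zero, so \<open>N\<close> is singular and has a nonzero kernel
    vector.\<close>
  have "N\<^sup>T *\<^sub>v unit_vec k r = 0\<^sub>v k"
    using \<open>r < k\<close> by (intro eq_vecI) (auto simp: N_def)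
  moreover have "unit_vec k r \<noteq> (0\<^sub>v k :: real vec)"
    using \<open>r < k\<close> by (metis index_unit_vec(2) index_zero_vec(1) zero_neq_one)
  ultimately have "det (N\<^sup>T) = 0"
    using det_0_iff_vec_prod_zero[of "N\<^sup>T" k] N unit_vec_carrier transpose_carrier_mat by blast
  then have "det N = 0"
    using det_transpose[OF N] by simp
  then obtain c where c: "c \<in> carrier_vec k" "c \<noteq> 0\<^sub>v k" "N *\<^sub>v c = 0\<^sub>v k"
    using det_0_iff_vec_prod_zero[OF N] by blast
  show thesis
  proof (rule that[OF c(1,2)])
    fix i assume i: "i < r"
    then have "(N *\<^sub>v c) $ i = (M *\<^sub>v c) $ i"
      using M \<open>r < k\<close> c(1) by (simp add: N_def scalar_prod_sum[OF c(1)])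
    then show "(M *\<^sub>v c) $ i = 0"
      using c(3) i \<open>r < k\<close> by simp
  qed
qed

lemma mat_diag_mult_vec:
  fixes c :: "real vec"
  assumes "c \<in> carrier_vec n"
  shows "mat_diag n f *\<^sub>v c = vec n (\<lambda>i. f i * c $ i)"
proof (rule eq_vecI)
  fix i assume i: "i < dim_vec (vec n (\<lambda>i. f i * c $ i))"
  then have "(mat_diag n f *\<^sub>v c) $ i = (\<Sum>j<n. (if i = j then f j else 0) * c $ j)"
    using assms by (simp add: mat_diag_def scalar_prod_sum[OF assms])
  also have "\<dots> = (\<Sum>j<n. if j = i then f i * c $ i else 0)"
    by (intro sum.cong) auto
  also have "\<dots> = f i * c $ i"
    using i by simp
  finally show "(mat_diag n f *\<^sub>v c) $ i = vec n (\<lambda>i. f i * c $ i) $ i"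
    using i by simp
qed (auto simp: mat_diag_def)

lemma isometry_scalar_prod:
  fixes V :: "real mat"
  assumes V: "V \<in> carrier_mat n k" "V\<^sup>T * V = 1\<^sub>m k" and c: "c \<in> carrier_vec k" "d \<in> carrier_vec k"
  shows "(V *\<^sub>v c) \<bullet> (V *\<^sub>v d) = c \<bullet> d"
proof -
  have "(V *\<^sub>v c) \<bullet> (V *\<^sub>v d) = (V\<^sup>T *\<^sub>v (V *\<^sub>v c)) \<bullet> d"
    using transpose_vec_mult_scalar[OF V(1) c(2), of "V *\<^sub>v c"] V(1) c by simp
  also have "V\<^sup>T *\<^sub>v (V *\<^sub>v c) = c"
    using assoc_mult_mat_vec[of "V\<^sup>T" k n V k c] V c by simp
  finally show ?thesis .
qed

text \<open>The lower half of Courant-Fischer: by dimension count the range of \<open>W\<close>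
  contains a nonzero vector orthogonal to the first \<open>k - 1\<close> eigenvectors, whose
  Rayleigh quotient is at least \<open>t\<close> and at most \<open>eigval B k\<close>. The columns
  of \<open>W\<close> need only be independent, which \<open>pos\<close> expresses; that also forces
  \<open>k \<le> m\<close>.\<close>

lemma eigval_ge_of_subspace:
  fixes B :: "real mat"
  assumes B: "B \<in> carrier_mat m m" "B\<^sup>T = B" and W: "W \<in> carrier_mat m k" and k: "1 \<le> k"
    and pos: "\<And>c. c \<in> carrier_vec k \<Longrightarrow> c \<noteq> 0\<^sub>v k \<Longrightarrow> 0 < (W *\<^sub>v c) \<bullet> (W *\<^sub>v c)"
    and ray: "\<And>c. c \<in> carrier_vec k \<Longrightarrow> c \<noteq> 0\<^sub>v k \<Longrightarrow>
      t * ((W *\<^sub>v c) \<bullet> (W *\<^sub>v c)) \<le> (W *\<^sub>v c) \<bullet> (B *\<^sub>v (W *\<^sub>v c))"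
  shows "k \<le> m \<and> t \<le> eigval B k"
proof -
  obtain Q where Q: "Q \<in> carrier_mat m m" "Q\<^sup>T * Q = 1\<^sub>m m" "Q * Q\<^sup>T = 1\<^sub>m m"
    "B * Q = Q * mat_diag m (\<lambda>i. eigval B (Suc i))"
    using symmetric_mat_eigval_diagonalization[OF B] by blast
  define D where "D = mat_diag m (\<lambda>i. eigval B (Suc i))"
  have D: "D \<in> carrier_mat m m" by (simp add: D_def)
  \<comment> \<open>The minimum keeps the row indices valid before \<open>k \<le> m\<close> is
    known. If \<open>k > m\<close>, then \<open>r = m\<close> and \<open>y\<close> is orthogonal to
    all eigenvectors, contradicting \<open>pos\<close>.\<close>
  define r where "r = min (k - 1) m"
  define M where "M = mat r k (\<lambda>(i, j). (Q\<^sup>T * W) $$ (i, j))"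
  have "M \<in> carrier_mat r k" "r < k"
    using k by (auto simp: M_def r_def)
  then obtain c where c: "c \<in> carrier_vec k" "c \<noteq> 0\<^sub>v k" "\<And>i. i < r \<Longrightarrow> (M *\<^sub>v c) $ i = 0"
    using underdetermined_system_solution by metis
  define y where "y = W *\<^sub>v c"
  have y: "y \<in> carrier_vec m" using W c(1) by (simp add: y_def)
  define d where "d = Q\<^sup>T *\<^sub>v y"
  have d: "d \<in> carrier_vec m" using Q y by (simp add: d_def)
  have d0: "d $ i = 0" if "i < r" for i
  proof -
    have "((Q\<^sup>T * W) *\<^sub>v c) $ i = (\<Sum>j<k. (Q\<^sup>T * W) $$ (i, j) * c $ j)"
      using that Q(1) W c(1) by (simp add: r_def scalar_prod_sum[OF c(1)] del: assoc_mult_mat_vec)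
    moreover have "d = (Q\<^sup>T * W) *\<^sub>v c"
      unfolding d_def y_def using Q(1) W c(1) by (simp add: assoc_mult_mat_vec[of _ m m _ k])
    ultimately have "d $ i = (\<Sum>j<k. (Q\<^sup>T * W) $$ (i, j) * c $ j)"
      by simp
    also have "\<dots> = (M *\<^sub>v c) $ i"
      using that c(1) by (simp add: M_def scalar_prod_sum[OF c(1)])
    finally show ?thesis
      using c(3) that by simp
  qed
  have yQ: "y = Q *\<^sub>v d"
    unfolding d_def using assoc_mult_mat_vec[of Q m m "Q\<^sup>T" m y] Q y by simp
  have yy: "y \<bullet> y = (\<Sum>i<m. (d $ i)\<^sup>2)"
    unfolding yQ using isometry_scalar_prod[OF Q(1,2) d d] scalar_prod_sum[OF d, of d]
    by (simp add: power2_eq_square)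
  have pos': "0 < y \<bullet> y"
    using pos c by (simp add: y_def)
  have "k \<le> m"
  proof (rule ccontr)
    assume "\<not> k \<le> m"
    then have "r = m" by (simp add: r_def)
    then have "y \<bullet> y = 0"
      unfolding yy using d0 by simp
    then show False using pos' by simp
  qed
  have "B *\<^sub>v y = (B * Q) *\<^sub>v d"
    unfolding yQ using assoc_mult_mat_vec[OF B(1) Q(1) d] by simp
  also have "\<dots> = Q *\<^sub>v (D *\<^sub>v d)"
    unfolding Q(4) D_def[symmetric] using assoc_mult_mat_vec[OF Q(1) D d] by simp
  finally have "y \<bullet> (B *\<^sub>v y) = d \<bullet> (D *\<^sub>v d)"
    using isometry_scalar_prod[OF Q(1,2) d, of "D *\<^sub>v d"] D d yQ by simp
  also have "\<dots> = (\<Sum>i<m. eigval B (Suc i) * (d $ i)\<^sup>2)"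
    unfolding D_def mat_diag_mult_vec[OF d]
    by (subst scalar_prod_sum[of _ m]) (auto simp: power2_eq_square ac_simps)
  \<comment> \<open>The first \<open>k - 1\<close> coordinates of \<open>d\<close> vanish, and the
    remaining eigenvalues are at most \<open>eigval B k\<close>.\<close>
  also have "\<dots> \<le> (\<Sum>i<m. eigval B k * (d $ i)\<^sup>2)"
  proof (rule sum_mono)
    fix i assume "i \<in> {..<m}"
    show "eigval B (Suc i) * (d $ i)\<^sup>2 \<le> eigval B k * (d $ i)\<^sup>2"
    proof (cases "i < r")
      case False
      then have "k \<le> Suc i" using \<open>k \<le> m\<close> by (auto simp: r_def)
      then show ?thesis
        using eigval_antimono[OF B k, of "Suc i"] \<open>i \<in> {..<m}\<close> by (intro mult_right_mono) auto
    qed (simp add: d0)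
  qed
  also have "\<dots> = eigval B k * (y \<bullet> y)"
    by (simp add: yy sum_distrib_left)
  finally have "t * (y \<bullet> y) \<le> eigval B k * (y \<bullet> y)"
    using ray[OF c(1,2)] unfolding y_def by linarith
  then show ?thesis
    using pos' \<open>k \<le> m\<close> by simp
qed

lemma symmetric_mat_top_eigenvectors:
  fixes A :: "real mat"
  assumes A: "A \<in> carrier_mat n n" "A\<^sup>T = A" and k: "k \<le> n"
  obtains V where "V \<in> carrier_mat n k" "V\<^sup>T * V = 1\<^sub>m k"
    "A * V = V * mat_diag k (\<lambda>i. eigval A (Suc i))"
proof -
  obtain Q where Q: "Q \<in> carrier_mat n n" "Q\<^sup>T * Q = 1\<^sub>m n" "Q * Q\<^sup>T = 1\<^sub>m n"
    and AQ: "A * Q = Q * mat_diag n (\<lambda>i. eigval A (Suc i))"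
    using symmetric_mat_eigval_diagonalization[OF A] by blast
  define V where "V = mat n k (\<lambda>(i, j). Q $$ (i, j))"
  have V: "V \<in> carrier_mat n k" by (simp add: V_def)
  show thesis
  proof (rule that[OF V])
    show "V\<^sup>T * V = 1\<^sub>m k"
    proof (rule eq_matI)
      fix i j assume "i < dim_row (1\<^sub>m k :: real mat)" "j < dim_col (1\<^sub>m k :: real mat)"
      then have ij: "i < k" "j < k" by auto
      have "(V\<^sup>T * V) $$ (i, j) = (Q\<^sup>T * Q) $$ (i, j)"
        using ij k Q(1) by (simp add: V_def scalar_prod_def)
      then show "(V\<^sup>T * V) $$ (i, j) = 1\<^sub>m k $$ (i, j)"
        using ij k Q(2) by simp
    qed (use V in auto)
    show "A * V = V * mat_diag k (\<lambda>i. eigval A (Suc i))"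
    proof (rule eq_matI)
      fix i j assume "i < dim_row (V * mat_diag k (\<lambda>i. eigval A (Suc i)))"
        "j < dim_col (V * mat_diag k (\<lambda>i. eigval A (Suc i)))"
      then have ij: "i < n" "j < k" using V by (auto simp: mat_diag_def)
      have "(A * V) $$ (i, j) = (A * Q) $$ (i, j)"
        using ij k Q(1) A(1) by (simp add: V_def scalar_prod_def)
      also have "\<dots> = Q $$ (i, j) * eigval A (Suc j)"
        unfolding AQ using ij k Q(1) by (simp add: mat_diag_mult_right[of _ n])
      also have "\<dots> = (V * mat_diag k (\<lambda>i. eigval A (Suc i))) $$ (i, j)"
        using ij V by (simp add: mat_diag_mult_right[of _ n] V_def)
      finally show "(A * V) $$ (i, j) = (V * mat_diag k (\<lambda>i. eigval A (Suc i))) $$ (i, j)" .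
    qed (use A V in \<open>auto simp: mat_diag_def\<close>)
  qed
qed

text \<open>Weyl's inequality, with the span of the top \<open>k\<close> eigenvectors of
  \<open>A\<close> as test space for \<open>G\<close>. The hypothesis is one-sided, so exchanging
  \<open>A\<close> and \<open>G\<close> gives the other direction.\<close>

lemma eigval_perturbation:
  fixes A G :: "real mat"
  assumes A: "A \<in> carrier_mat n n" "A\<^sup>T = A" and G: "G \<in> carrier_mat n n" "G\<^sup>T = G"
    and diff: "\<And>x. x \<in> carrier_vec n \<Longrightarrow> x \<bullet> (A *\<^sub>v x) - x \<bullet> (G *\<^sub>v x) \<le> e * (x \<bullet> x)"
    and k: "1 \<le> k" "k \<le> n"
  shows "eigval A k - e \<le> eigval G k"
proof -
  obtain V where V: "V \<in> carrier_mat n k" "V\<^sup>T * V = 1\<^sub>m k"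
    and AV: "A * V = V * mat_diag k (\<lambda>i. eigval A (Suc i))"
    using symmetric_mat_top_eigenvectors[OF A k(2)] by blast
  define D where "D = mat_diag k (\<lambda>i. eigval A (Suc i))"
  have D: "D \<in> carrier_mat k k" by (simp add: D_def)
  show ?thesis
  proof (rule eigval_ge_of_subspace[OF G V(1) k(1), THEN conjunct2])
    fix c :: "real vec" assume c: "c \<in> carrier_vec k" "c \<noteq> 0\<^sub>v k"
    have nn: "(V *\<^sub>v c) \<bullet> (V *\<^sub>v c) = c \<bullet> c"
      by (rule isometry_scalar_prod[OF V c(1) c(1)])
    show "0 < (V *\<^sub>v c) \<bullet> (V *\<^sub>v c)"
      unfolding nn using scalar_prod_eq_0_iff[OF c(1)] c(2) scalar_prod_ge_0[of c] by linarith
    have "A *\<^sub>v (V *\<^sub>v c) = V *\<^sub>v (D *\<^sub>v c)"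
      using assoc_mult_mat_vec[OF A(1) V(1) c(1)] assoc_mult_mat_vec[OF V(1) D c(1)]
      by (simp add: AV D_def)
    then have "(V *\<^sub>v c) \<bullet> (A *\<^sub>v (V *\<^sub>v c)) = c \<bullet> (D *\<^sub>v c)"
      using isometry_scalar_prod[OF V c(1), of "D *\<^sub>v c"] D c by simp
    also have "\<dots> = (\<Sum>i<k. eigval A (Suc i) * (c $ i)\<^sup>2)"
      unfolding D_def mat_diag_mult_vec[OF c(1)]
      by (subst scalar_prod_sum[of _ k]) (auto simp: power2_eq_square ac_simps)
    also have "\<dots> \<ge> (\<Sum>i<k. eigval A k * (c $ i)\<^sup>2)"
      using eigval_antimono[OF A] k by (intro sum_mono mult_right_mono) auto
    also have "(\<Sum>i<k. eigval A k * (c $ i)\<^sup>2) = eigval A k * (c \<bullet> c)"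
      by (simp add: scalar_prod_sum[OF c(1)] sum_distrib_left power2_eq_square)
    finally show "(eigval A k - e) * ((V *\<^sub>v c) \<bullet> (V *\<^sub>v c)) \<le> (V *\<^sub>v c) \<bullet> (G *\<^sub>v (V *\<^sub>v c))"
      using diff[of "V *\<^sub>v c"] V c unfolding nn by (simp add: algebra_simps)
  qed
qed

section \<open>Approximately intertwined symmetric matrices\<close>

text \<open>
  With \<open>nu\<close>, \<open>a\<close>, \<open>ny\<close> the norms of \<open>u\<close>, \<open>A u\<close> and \<open>y = K u\<close>, the quantities \<open>p\<close> and \<open>q\<close> are
  the errors in \<open>y \<bullet> y \<approx> A u \<bullet> A u\<close> and \<open>y \<bullet> B y \<approx> A u \<bullet> A (A u)\<close>.
\<close>

lemma intertwining_estimate: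
  fixes l \<theta> \<beta> nu a ny p q yBy cube :: real
  assumes "0 < \<theta>" "\<theta> \<le> l" "0 \<le> \<beta>" "6 * \<beta> \<le> \<theta>\<^sup>2" "0 < nu" "0 \<le> ny" "l * nu \<le> a"
    "\<bar>p\<bar> \<le> \<beta> * nu\<^sup>2" "ny\<^sup>2 = a\<^sup>2 + p" "\<bar>q\<bar> \<le> \<beta> * nu * a + \<beta> * nu * ny"
    "l * a\<^sup>2 \<le> cube" "yBy = cube + q"
  shows "0 < ny\<^sup>2" "(l - \<theta>) * ny\<^sup>2 \<le> yBy"
proof -
  have tn: "\<theta> * nu \<le> a"
    using assms mult_right_mono[of \<theta> l nu] by linarith
  have a: "0 < a"
    using tn assms mult_pos_pos[of \<theta> nu] by linarith
  \<comment> \<open>The bounds \<open>6 * \<beta> \<le> \<theta>\<^sup>2\<close> and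
    \<open>\<theta> * nu \<le> a\<close> make the error relative to \<open>a\<close>, the norm of
    \<open>A u\<close>.\<close>
  have bn: "6 * (\<beta> * nu) \<le> \<theta> * a"
  proof -
    have "6 * \<beta> * nu \<le> \<theta>\<^sup>2 * nu" using assms by (intro mult_right_mono) auto
    also have "\<dots> = \<theta> * (\<theta> * nu)" by (simp add: power2_eq_square)
    also have "\<dots> \<le> \<theta> * a" using tn assms by (intro mult_left_mono) auto
    finally show ?thesis by simp
  qed
  have bnn: "6 * (\<beta> * nu\<^sup>2) \<le> a\<^sup>2"
  proof -
    have "6 * (\<beta> * nu\<^sup>2) = 6 * (\<beta> * nu) * nu" by (simp add: power2_eq_square)
    also have "\<dots> \<le> \<theta> * a * nu" using bn assms by (intro mult_right_mono) auto
    also have "\<dots> = (\<theta> * nu) * a" by simp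
    also have "\<dots> \<le> a * a" using tn a by (intro mult_right_mono) auto
    finally show ?thesis by (simp add: power2_eq_square)
  qed
  have ny2: "5 * a\<^sup>2 \<le> 6 * ny\<^sup>2"
    using bnn assms by linarith
  moreover have "0 < a\<^sup>2" using a by simp
  ultimately show "0 < ny\<^sup>2" by linarith
  have "a\<^sup>2 \<le> 4 * ny\<^sup>2"
    using ny2 zero_le_power2[of ny] zero_le_power2[of a] by linarith
  then have "a\<^sup>2 \<le> (2 * ny)\<^sup>2"
    by (simp add: power_mult_distrib)
  then have any: "a \<le> 2 * ny"
    by (rule power2_le_imp_le) (use \<open>0 \<le> ny\<close> in simp)
  \<comment> \<open>Passing from \<open>l * a\<^sup>2\<close> to \<open>l * ny\<^sup>2\<close> costs
    \<open>l * p\<close>. Here \<open>l\<close> may be far larger than \<open>\<theta>\<close>, but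
    \<open>l * nu \<le> a\<close> absorbs it.\<close>
  have lp: "l * \<bar>p\<bar> \<le> \<beta> * nu * a"
  proof -
    have "l * \<bar>p\<bar> \<le> l * (\<beta> * nu\<^sup>2)" using assms by (intro mult_left_mono) auto
    also have "\<dots> = \<beta> * nu * (l * nu)" by (simp add: power2_eq_square)
    also have "\<dots> \<le> \<beta> * nu * a" using assms by (intro mult_left_mono) auto
    finally show ?thesis .
  qed
  \<comment> \<open>The total error: one \<open>\<beta> * nu * a\<close> comes from
    \<open>l * p\<close>, the second one and \<open>\<beta> * nu * ny\<close> come from
    \<open>q\<close>.\<close>
  have "\<beta> * nu * (2 * a + ny) \<le> (\<theta> * a / 6) * (2 * a + ny)"
    using bn a assms by (intro mult_right_mono) auto
  also have "\<dots> = \<theta> / 6 * (2 * a\<^sup>2 + a * ny)"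
    by (simp add: power2_eq_square algebra_simps)
  also have "\<dots> \<le> \<theta> / 6 * (6 * ny\<^sup>2)"
  proof -
    have "a * ny \<le> 2 * ny * ny" using any assms by (intro mult_right_mono) auto
    then have "2 * a\<^sup>2 + a * ny \<le> 6 * ny\<^sup>2"
      using ny2 zero_le_power2[of ny] unfolding power2_eq_square by linarith
    then show ?thesis using assms by (intro mult_left_mono) auto
  qed
  finally have err: "\<beta> * nu * (2 * a + ny) \<le> \<theta> * ny\<^sup>2" by simp
  have "l * p \<le> l * \<bar>p\<bar>"
    using assms by (intro mult_left_mono) auto
  then have "l * p \<le> \<beta> * nu * a"
    using lp by linarith
  then have "l * ny\<^sup>2 \<le> l * a\<^sup>2 + \<beta> * nu * a"
    using assms by (simp add: algebra_simps)
  then show "(l - \<theta>) * ny\<^sup>2 \<le> yBy"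
    using err assms by (simp add: algebra_simps)
qed

text \<open>The test space for \<open>B\<close> is the image under \<open>K\<close> of the top
  \<open>k\<close> eigenvectors of \<open>A\<close>. Closeness of \<open>K\<^sup>T * K\<close> to
  \<open>A * A\<close> keeps \<open>K\<close> injective there, since \<open>A\<close> stretches
  these vectors by at least \<open>\<theta>\<close>; closeness of \<open>B * K\<close> to
  \<open>K * A\<close> transfers the Rayleigh quotient. The Gram matrix compares squared norms,
  hence \<open>\<beta>\<close> against \<open>\<theta>\<^sup>2\<close>.\<close>

lemma eigval_ge_of_intertwining:
  fixes A B K :: "real mat"
  assumes A: "A \<in> carrier_mat n n" "A\<^sup>T = A" and B: "B \<in> carrier_mat m m" "B\<^sup>T = B"
    and K: "K \<in> carrier_mat m n"
    and E: "frobenius_sq (K\<^sup>T * K - A * A) \<le> \<beta>\<^sup>2"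
    and F: "frobenius_sq (B * K - K * A) \<le> \<beta>\<^sup>2"
    and \<beta>: "0 \<le> \<beta>" "6 * \<beta> \<le> \<theta>\<^sup>2" and \<theta>: "0 < \<theta>" "\<theta> \<le> eigval A k"
    and k: "1 \<le> k" "k \<le> n"
  shows "k \<le> m \<and> eigval A k - \<theta> \<le> eigval B k"
proof -
  obtain V where V: "V \<in> carrier_mat n k" "V\<^sup>T * V = 1\<^sub>m k"
    and AV: "A * V = V * mat_diag k (\<lambda>i. eigval A (Suc i))"
    using symmetric_mat_top_eigenvectors[OF A k(2)] by blast
  define D where "D = mat_diag k (\<lambda>i. eigval A (Suc i))"
  have D: "D \<in> carrier_mat k k" by (simp add: D_def)
  have KV: "K * V \<in> carrier_mat m k" using K V by simp
  have top: "eigval A k \<le> eigval A (Suc i)" if "i < k" for i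
    using eigval_antimono[OF A] that k by auto
  have main: "0 < ((K * V) *\<^sub>v c) \<bullet> ((K * V) *\<^sub>v c) \<and>
      (eigval A k - \<theta>) * (((K * V) *\<^sub>v c) \<bullet> ((K * V) *\<^sub>v c))
        \<le> ((K * V) *\<^sub>v c) \<bullet> (B *\<^sub>v ((K * V) *\<^sub>v c))"
    if c: "c \<in> carrier_vec k" "c \<noteq> 0\<^sub>v k" for c
  proof -
    define u where "u = V *\<^sub>v c"
    define w where "w = A *\<^sub>v u"
    define y where "y = K *\<^sub>v u"
    define E' where "E' = K\<^sup>T * K - A * A"
    define F' where "F' = B * K - K * A"
    have E': "E' \<in> carrier_mat n n" and F': "F' \<in> carrier_mat m n"
      using A B K by (auto simp: E'_def F'_def)
    have u: "u \<in> carrier_vec n" and w: "w \<in> carrier_vec n" and y: "y \<in> carrier_vec m"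
      using V A K c(1) by (auto simp: u_def w_def y_def)
    have Eu: "E' *\<^sub>v u \<in> carrier_vec n" and Fu: "F' *\<^sub>v u \<in> carrier_vec m"
      using E' F' u by auto
    have y_eq: "(K * V) *\<^sub>v c = y"
      unfolding y_def u_def using assoc_mult_mat_vec[OF K V(1) c(1)] by simp
    have AVc: "A *\<^sub>v (V *\<^sub>v d) = V *\<^sub>v (D *\<^sub>v d)" if "d \<in> carrier_vec k" for d
      using assoc_mult_mat_vec[OF A(1) V(1) that] assoc_mult_mat_vec[OF V(1) D that]
      by (simp add: AV D_def)
    have Dc: "D *\<^sub>v c \<in> carrier_vec k" and DDc: "D *\<^sub>v (D *\<^sub>v c) \<in> carrier_vec k"
      using D c(1) by auto
    have wV: "w = V *\<^sub>v (D *\<^sub>v c)" and AwV: "A *\<^sub>v w = V *\<^sub>v (D *\<^sub>v (D *\<^sub>v c))"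
      using AVc[OF c(1)] AVc[OF Dc] by (auto simp: w_def u_def)
    have uu: "u \<bullet> u = (\<Sum>i<k. (c $ i)\<^sup>2)"
      unfolding u_def isometry_scalar_prod[OF V c(1) c(1)] scalar_prod_sum[OF c(1)]
      by (simp add: power2_eq_square)
    have Dci: "(D *\<^sub>v c) $ i = eigval A (Suc i) * c $ i" if "i < k" for i
      unfolding D_def mat_diag_mult_vec[OF c(1)] using that by simp
    have DDci: "(D *\<^sub>v (D *\<^sub>v c)) $ i = eigval A (Suc i) * (D *\<^sub>v c) $ i" if "i < k" for i
      using mat_diag_mult_vec[OF Dc, of "\<lambda>i. eigval A (Suc i)"] that by (simp add: D_def)
    have ww: "w \<bullet> w = (\<Sum>i<k. (eigval A (Suc i))\<^sup>2 * (c $ i)\<^sup>2)"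
      unfolding wV isometry_scalar_prod[OF V Dc Dc] scalar_prod_sum[OF Dc]
      by (intro sum.cong) (auto simp: Dci power2_eq_square)
    have wAw: "w \<bullet> (A *\<^sub>v w) = (\<Sum>i<k. eigval A (Suc i) * ((eigval A (Suc i))\<^sup>2 * (c $ i)\<^sup>2))"
      unfolding AwV unfolding wV isometry_scalar_prod[OF V Dc DDc] scalar_prod_sum[OF DDc]
      by (intro sum.cong) (auto simp: Dci DDci power2_eq_square)
    have KKu: "K\<^sup>T *\<^sub>v y = A *\<^sub>v w + E' *\<^sub>v u"
    proof -
      have AAu: "A *\<^sub>v w = (A * A) *\<^sub>v u"
        using assoc_mult_mat_vec[OF A(1) A(1) u] by (simp add: w_def)
      have KTK: "K\<^sup>T *\<^sub>v y = (K\<^sup>T * K) *\<^sub>v u"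
        using assoc_mult_mat_vec[of "K\<^sup>T" n m K n u] K u by (simp add: y_def)
      have "A * A + E' = K\<^sup>T * K"
        unfolding E'_def using A K by (intro eq_matI) auto
      then show ?thesis
        unfolding AAu KTK using add_mult_distrib_mat_vec[of "A * A" n n E' u] A E' u by simp
    qed
    have BKu: "B *\<^sub>v y = K *\<^sub>v w + F' *\<^sub>v u"
    proof -
      have KAu: "K *\<^sub>v w = (K * A) *\<^sub>v u"
        using assoc_mult_mat_vec[OF K A(1) u] by (simp add: w_def)
      have BK: "B *\<^sub>v y = (B * K) *\<^sub>v u"
        using assoc_mult_mat_vec[OF B(1) K u] by (simp add: y_def)
      have "K * A + F' = B * K"
        unfolding F'_def using A B K by (intro eq_matI) auto
      then show ?thesis
        unfolding KAu BK using add_mult_distrib_mat_vec[of "K * A" m n F' u] A K F' u by simp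
    qed
    have Aw: "A *\<^sub>v w \<in> carrier_vec n" and Kw: "K *\<^sub>v w \<in> carrier_vec m"
      using A K w by auto
    have "u \<bullet> (A *\<^sub>v w) = w \<bullet> w"
      using transpose_vec_mult_scalar[OF A(1) w u] A(2) by (simp add: w_def)
    moreover have "y \<bullet> y = u \<bullet> (K\<^sup>T *\<^sub>v y)"
      using transpose_vec_mult_scalar[OF K u y] comm_scalar_prod[of u n "K\<^sup>T *\<^sub>v y"] K u y
      by (simp add: y_def)
    ultimately have yy: "y \<bullet> y = w \<bullet> w + u \<bullet> (E' *\<^sub>v u)"
      unfolding KKu using scalar_prod_add_distrib[OF u Aw Eu] by simp
    have "y \<bullet> (K *\<^sub>v w) = (K\<^sup>T *\<^sub>v y) \<bullet> w"
      using transpose_vec_mult_scalar[OF K w y] by simp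
    also have "\<dots> = w \<bullet> (A *\<^sub>v w) + (E' *\<^sub>v u) \<bullet> w"
      unfolding KKu using add_scalar_prod_distrib[OF Aw Eu w] comm_scalar_prod[OF Aw w] by simp
    finally have yBy: "y \<bullet> (B *\<^sub>v y) = w \<bullet> (A *\<^sub>v w) + ((E' *\<^sub>v u) \<bullet> w + y \<bullet> (F' *\<^sub>v u))"
      unfolding BKu using scalar_prod_add_distrib[OF y Kw Fu] by simp
    have nE: "vnorm (E' *\<^sub>v u) \<le> \<beta> * vnorm u" and nF: "vnorm (F' *\<^sub>v u) \<le> \<beta> * vnorm u"
      using vnorm_mult_mat_vec_le[OF E' u _ \<beta>(1)] vnorm_mult_mat_vec_le[OF F' u _ \<beta>(1)] E F
      by (auto simp: E'_def F'_def)
    have "u \<bullet> u = c \<bullet> c"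
      unfolding u_def by (rule isometry_scalar_prod[OF V c(1) c(1)])
    then have "0 < u \<bullet> u"
      using scalar_prod_eq_0_iff[OF c(1)] c(2) scalar_prod_ge_0[of c] by linarith
    then have nu: "0 < vnorm u"
      by (simp add: vnorm_def)
    have l0: "0 < eigval A k"
      using \<theta> by linarith
    have "(eigval A k * vnorm u)\<^sup>2 = (\<Sum>i<k. (eigval A k)\<^sup>2 * (c $ i)\<^sup>2)"
      by (simp add: power_mult_distrib vnorm_square uu sum_distrib_left)
    also have "\<dots> \<le> (vnorm w)\<^sup>2"
      unfolding vnorm_square ww using top l0 by (intro sum_mono mult_right_mono power_mono) auto
    finally have le_w: "eigval A k * vnorm u \<le> vnorm w"
      using vnorm_ge_0 by (rule power2_le_imp_le)
    \<comment> \<open>In eigencoordinates this is the cubic form of \<open>A\<close> at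
      \<open>u\<close>: each summand of \<open>w \<bullet> w\<close> gains a further factor that is
      at least \<open>eigval A k\<close>.\<close>
    have cube: "eigval A k * (vnorm w)\<^sup>2 \<le> w \<bullet> (A *\<^sub>v w)"
      unfolding vnorm_square wAw unfolding ww sum_distrib_left
      using top by (intro sum_mono mult_right_mono) auto
    have p: "\<bar>u \<bullet> (E' *\<^sub>v u)\<bar> \<le> \<beta> * (vnorm u)\<^sup>2"
      using vec_Cauchy_Schwarz[OF u Eu] mult_left_mono[OF nE vnorm_ge_0[of u]]
      by (simp add: power2_eq_square mult.left_commute)
    have q1: "\<bar>(E' *\<^sub>v u) \<bullet> w\<bar> \<le> \<beta> * vnorm u * vnorm w"
      using vec_Cauchy_Schwarz[OF Eu w] mult_right_mono[OF nE vnorm_ge_0[of w]] by linarith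
    have q2: "\<bar>y \<bullet> (F' *\<^sub>v u)\<bar> \<le> \<beta> * vnorm u * vnorm y"
      using vec_Cauchy_Schwarz[OF y Fu] mult_left_mono[OF nF vnorm_ge_0[of y]]
      by (simp add: mult.commute)
    have yy': "(vnorm y)\<^sup>2 = (vnorm w)\<^sup>2 + u \<bullet> (E' *\<^sub>v u)"
      by (simp add: vnorm_square yy)
    have q: "\<bar>(E' *\<^sub>v u) \<bullet> w + y \<bullet> (F' *\<^sub>v u)\<bar> \<le> \<beta> * vnorm u * vnorm w + \<beta> * vnorm u * vnorm y"
      using q1 q2 by linarith
    show ?thesis
      unfolding y_eq vnorm_square[symmetric, of y]
      using intertwining_estimate[OF \<theta> \<beta> nu vnorm_ge_0 le_w p yy' q cube yBy] by simp
  qed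
  show ?thesis
    by (rule eigval_ge_of_subspace[OF B KV k(1)]) (use main in auto)
qed

text \<open>Negating both \<open>A\<close> and \<open>B\<close> leaves \<open>A * A\<close>
  unchanged and only flips the sign of \<open>B * K - K * A\<close>, so the bound for the top of the
  spectrum applies with the same \<open>K\<close>.\<close>

lemma eigval_le_of_intertwining:
  fixes A B K :: "real mat"
  assumes A: "A \<in> carrier_mat n n" "A\<^sup>T = A" and B: "B \<in> carrier_mat m m" "B\<^sup>T = B"
    and K: "K \<in> carrier_mat m n"
    and E: "frobenius_sq (K\<^sup>T * K - A * A) \<le> \<beta>\<^sup>2"
    and F: "frobenius_sq (B * K - K * A) \<le> \<beta>\<^sup>2"
    and \<beta>: "0 \<le> \<beta>" "6 * \<beta> \<le> \<theta>\<^sup>2" and \<theta>: "0 < \<theta>" "eigval A (n + 1 - k) \<le> - \<theta>"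
    and k: "1 \<le> k" "k \<le> n"
  shows "k \<le> m \<and> eigval B (m + 1 - k) \<le> eigval A (n + 1 - k) + \<theta>"
proof -
  have *: "- A \<in> carrier_mat n n" "(- A)\<^sup>T = - A" "- B \<in> carrier_mat m m" "(- B)\<^sup>T = - B"
    using A B by (auto simp: transpose_uminus)
  have E': "frobenius_sq (K\<^sup>T * K - (- A) * (- A)) \<le> \<beta>\<^sup>2"
  proof -
    have "(- A) * (- A) = A * A"
      using A by simp
    then show ?thesis using E by simp
  qed
  have F': "frobenius_sq ((- B) * K - K * (- A)) \<le> \<beta>\<^sup>2"
  proof -
    have "(- B) * K - K * (- A) = - (B * K - K * A)"
      using A B K by (intro eq_matI) auto
    then show ?thesis using F by (simp add: frobenius_sq_uminus)
  qed
  have th: "\<theta> \<le> eigval (- A) k"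
    using eigval_uminus[OF A k] \<theta> by simp
  have "k \<le> m \<and> eigval (- A) k - \<theta> \<le> eigval (- B) k"
    by (rule eigval_ge_of_intertwining[OF * K E' F' \<beta> \<theta>(1) th k])
  then show ?thesis
    using eigval_uminus[OF A k] eigval_uminus[OF B k(1)] by auto
qed

text \<open>Eigenvalues of \<open>M\<close> or \<open>G\<close> of size at least
  \<open>\<theta>\<close> have partners in the other matrix at the same rank, counted from the top
  if positive and from the bottom if negative. All others are within \<open>\<theta>\<close> of 0,
  where the zero padding costs little. Weyl's inequality then passes from \<open>G\<close> to
  \<open>A\<close> at cost \<open>e\<close>.\<close>

lemma merged_spectrum_error:
  fixes A G M K :: "real mat" and n k :: nat
  assumes A: "A \<in> carrier_mat n n" "A\<^sup>T = A" and G: "G \<in> carrier_mat n n" "G\<^sup>T = G"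
    and M: "M \<in> carrier_mat k k" "M\<^sup>T = M" and K: "K \<in> carrier_mat n k" and kn: "k \<le> n"
    and E1: "frobenius_sq (K\<^sup>T * K - M * M) \<le> \<beta>\<^sup>2"
    and E2: "frobenius_sq (K * K\<^sup>T - G * G) \<le> \<beta>\<^sup>2"
    and F: "frobenius_sq (G * K - K * M) \<le> \<beta>\<^sup>2"
    and \<beta>: "0 \<le> \<beta>" "6 * \<beta> \<le> \<theta>\<^sup>2" and \<theta>: "0 < \<theta>"
    and diff: "\<And>x. x \<in> carrier_vec n \<Longrightarrow> \<bar>x \<bullet> (A *\<^sub>v x) - x \<bullet> (G *\<^sub>v x)\<bar> \<le> e * (x \<bullet> x)"
    and j: "1 \<le> j" "j \<le> n"
  shows "\<bar>(if j \<in> {1..k} \<and> eigval M j \<ge> 0 then eigval M j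
      else if j \<in> {n - k + 1..n} \<and> eigval M (j - (n - k)) < 0 then eigval M (j - (n - k))
      else 0) - eigval A j\<bar> \<le> 2 * \<theta> + e"
proof -
  have E2': "frobenius_sq ((K\<^sup>T)\<^sup>T * K\<^sup>T - G * G) \<le> \<beta>\<^sup>2"
    using E2 by simp
  have F': "frobenius_sq (M * K\<^sup>T - K\<^sup>T * G) \<le> \<beta>\<^sup>2"
  proof -
    have "(G * K - K * M)\<^sup>T = (G * K)\<^sup>T - (K * M)\<^sup>T"
      using G K M by (intro transpose_minus) auto
    also have "\<dots> = K\<^sup>T * G - M * K\<^sup>T"
      using G K M by (simp add: transpose_mult[of _ n n _ k] transpose_mult[of _ n k _ k])
    also have "\<dots> = - (M * K\<^sup>T - K\<^sup>T * G)"
      using G K M by (intro eq_matI) auto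
    finally show ?thesis
      using F by (metis frobenius_sq_transpose frobenius_sq_uminus)
  qed
  have KT: "K\<^sup>T \<in> carrier_mat k n" using K by simp
  note upM = eigval_ge_of_intertwining[OF M G K E1 F \<beta> \<theta>, THEN conjunct2]
  note upG = eigval_ge_of_intertwining[OF G M KT E2' F' \<beta> \<theta>]
  note dnM = eigval_le_of_intertwining[OF M G K E1 F \<beta> \<theta>, THEN conjunct2]
  note dnG = eigval_le_of_intertwining[OF G M KT E2' F' \<beta> \<theta>]
  have "eigval A j - e \<le> eigval G j"
    by (rule eigval_perturbation[OF A G _ j]) (use diff in \<open>auto simp: abs_le_iff\<close>)
  moreover have "eigval G j - e \<le> eigval A j"
    by (rule eigval_perturbation[OF G A _ j]) (use diff in \<open>fastforce simp: abs_le_iff\<close>)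
  ultimately have AG: "\<bar>eigval A j - eigval G j\<bar> \<le> e" by linarith
  \<comment> \<open>The rank of \<open>j\<close> counted from the bottom. In \<open>M\<close> the
    same rank from the bottom has index \<open>k + 1 - ?j = j - (n - k)\<close>.\<close>
  let ?j = "n + 1 - j"
  have jj: "n + 1 - ?j = j" "1 \<le> ?j" "?j \<le> n" using j by auto
  consider (nonneg) "j \<le> k" "0 \<le> eigval M j"
    | (neg) "n - k + 1 \<le> j" "eigval M (j - (n - k)) < 0" "\<not> (j \<le> k \<and> 0 \<le> eigval M j)"
    | (zero) "\<not> (j \<le> k \<and> 0 \<le> eigval M j)" "\<not> (n - k + 1 \<le> j \<and> eigval M (j - (n - k)) < 0)"
    by blast
  then show ?thesis
  proof cases
    case nonneg
    \<comment> \<open>Otherwise \<open>dnG\<close> makes \<open>eigval M (j - (n - k))\<close>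
      negative, and \<open>eigval M j\<close>, which has the larger index, is no greater.\<close>
    have "- \<theta> \<le> eigval G j"
    proof (rule ccontr)
      assume neg: "\<not> - \<theta> \<le> eigval G j"
      then have *: "?j \<le> k \<and> eigval M (k + 1 - ?j) \<le> eigval G j + \<theta>"
        using dnG[of ?j] unfolding jj(1) using jj by linarith
      moreover have "eigval M j \<le> eigval M (k + 1 - ?j)"
        using * nonneg j kn by (intro eigval_antimono[OF M]) auto
      ultimately show False using neg nonneg by linarith
    qed
    moreover have "\<theta> \<le> eigval M j \<Longrightarrow> eigval M j - \<theta> \<le> eigval G j"
      using upM j nonneg by blast
    moreover have "\<theta> \<le> eigval G j \<Longrightarrow> eigval G j - \<theta> \<le> eigval M j"
      using upG j by blast
    \<comment> \<open>The full \<open>2 * \<theta>\<close> is approached when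
      \<open>eigval M j\<close> is just below \<open>\<theta>\<close> and \<open>eigval G j\<close>
      is near \<open>- \<theta>\<close>; the other combinations cost at most
      \<open>\<theta>\<close>.\<close>
    ultimately have "\<bar>eigval M j - eigval G j\<bar> \<le> 2 * \<theta>"
      using nonneg \<theta>
      by (cases "\<theta> \<le> eigval M j"; cases "\<theta> \<le> eigval G j") (auto simp: abs_le_iff)
    then have err: "\<bar>eigval M j - eigval A j\<bar> \<le> 2 * \<theta> + e"
      using AG by linarith
    then show ?thesis
      using nonneg j by simp
  next
    case neg
    let ?i = "j - (n - k)"
    have i: "1 \<le> ?i" "?i \<le> k" "?i \<le> j" "k + 1 - ?j = ?i" "?j \<le> k"
      using neg j kn by auto
    have "eigval G j \<le> \<theta>"
    proof (rule ccontr)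
      assume pos: "\<not> eigval G j \<le> \<theta>"
      then have *: "j \<le> k \<and> eigval G j - \<theta> \<le> eigval M j"
        using upG[of j] j by linarith
      moreover have "eigval M j \<le> eigval M ?i"
        using * i by (intro eigval_antimono[OF M]) auto
      ultimately show False using pos neg by linarith
    qed
    moreover have "eigval M ?i \<le> - \<theta> \<Longrightarrow> eigval G j \<le> eigval M ?i + \<theta>"
      using dnM[of ?j] unfolding jj(1) i(4) using i jj by blast
    moreover have "eigval G j \<le> - \<theta> \<Longrightarrow> eigval M ?i \<le> eigval G j + \<theta>"
      using dnG[of ?j] unfolding jj(1) i(4) using i jj by blast
    ultimately have "\<bar>eigval M ?i - eigval G j\<bar> \<le> 2 * \<theta>"
      using neg(2) \<theta>
      by (cases "eigval M ?i \<le> - \<theta>"; cases "eigval G j \<le> - \<theta>") (auto simp: abs_le_iff)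
    then have err: "\<bar>eigval M ?i - eigval A j\<bar> \<le> 2 * \<theta> + e"
      using AG by linarith
    then show ?thesis
      using neg j by auto
  next
    case zero
    \<comment> \<open>An eigenvalue of \<open>G\<close> outside
      \<open>[- \<theta>, \<theta>]\<close> would have a partner of the same sign in
      \<open>M\<close>, and then one of the first two branches would apply.\<close>
    have "eigval G j \<le> \<theta>"
    proof (rule ccontr)
      assume pos: "\<not> eigval G j \<le> \<theta>"
      then have "j \<le> k" "eigval G j - \<theta> \<le> eigval M j"
        using upG[of j] j by auto
      then show False using pos zero by auto
    qed
    moreover have "- \<theta> \<le> eigval G j"
    proof (rule ccontr)
      assume neg: "\<not> - \<theta> \<le> eigval G j"
      then have *: "?j \<le> k" "eigval M (k + 1 - ?j) \<le> eigval G j + \<theta>"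
        using dnG[of ?j] unfolding jj(1) using jj by auto
      then have "n - k + 1 \<le> j" "k + 1 - ?j = j - (n - k)"
        using kn j by auto
      then show False using * neg zero by auto
    qed
    ultimately have "\<bar>eigval G j\<bar> \<le> \<theta>" by simp
    then have err: "\<bar>0 - eigval A j\<bar> \<le> 2 * \<theta> + e"
      using AG \<theta> by linarith
    show ?thesis
      using zero err by auto
  qed
qed

section \<open>Inverse-probability weights of a random subset\<close>

text \<open>The Horvitz-Thompson weight, which has mean 1 whenever \<open>i\<close> is included with
  probability \<open>p i > 0\<close>.\<close>

definition sample_weight :: "(nat \<Rightarrow> real) \<Rightarrow> nat set \<Rightarrow> nat \<Rightarrow> real" where
  "sample_weight p S i = (if i \<in> S then 1 / p i else 0)"

lemma set_random_subset: "S \<in> set_pmf (random_subset n p) \<Longrightarrow> S \<subseteq> {..<n}"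
  by (auto simp: random_subset_def)

lemma integrable_random_subset: "integrable (measure_pmf (random_subset n p)) (f :: nat set \<Rightarrow> real)"
proof (rule integrable_measure_pmf_finite)
  show "finite (set_pmf (random_subset n p))"
    by (rule finite_subset[of _ "Pow {..<n}"]) (auto dest: set_random_subset)
qed

lemma expectation_prod_sample_weight:
  assumes p: "\<forall>i<n. 0 < p i \<and> p i \<le> 1" and T: "T \<subseteq> {..<n}"
  shows "measure_pmf.expectation (random_subset n p) (\<lambda>S. \<Prod>i\<in>T. sample_weight p S i) = 1"
proof -
  \<comment> \<open>Factors outside \<open>T\<close> are set to 1, so that the product runs over all
    independent coordinates.\<close>
  define f where "f i b = (if i \<in> T then (if b then 1 / p i else 0) else 1)" for i and b :: bool
  have eq: "(\<Prod>i\<in>T. sample_weight p {i \<in> {..<n}. X i} i) = (\<Prod>i<n. f i (X i))" for X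
  proof -
    have "(\<Prod>i<n. f i (X i)) = (\<Prod>i\<in>T. f i (X i))"
      using T by (intro prod.mono_neutral_right) (auto simp: f_def)
    also have "\<dots> = (\<Prod>i\<in>T. sample_weight p {i \<in> {..<n}. X i} i)"
      using T by (intro prod.cong) (auto simp: f_def sample_weight_def)
    finally show ?thesis by simp
  qed
  have "measure_pmf.expectation (random_subset n p) (\<lambda>S. \<Prod>i\<in>T. sample_weight p S i)
      = measure_pmf.expectation (Pi_pmf {..<n} False (\<lambda>i. bernoulli_pmf (p i))) (\<lambda>X. \<Prod>i<n. f i (X i))"
    unfolding random_subset_def integral_map_pmf eq ..
  also have "\<dots> = (\<Prod>i<n. measure_pmf.expectation (bernoulli_pmf (p i)) (f i))"
  proof (rule expectation_prod_Pi_pmf)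
    show "integrable (measure_pmf (bernoulli_pmf (p i))) (f i)" for i
      by (rule integrable_measure_pmf_finite) simp
    show "0 \<le> f i b" if "i \<in> {..<n}" for i b
      using p that by (auto simp: f_def)
  qed simp
  also have "\<dots> = (\<Prod>i<n. 1)"
    using p by (intro prod.cong) (force simp: f_def)+
  finally show ?thesis by simp
qed

text \<open>By independence the weights in \<open>T\<close> average out to 1, deviations at distinct
  indices are uncorrelated, and a single deviation has variance \<open>1 / p k - 1\<close>. The
  proof expands into products of distinct weights, each of mean 1.\<close>

lemma expectation_sample_weight_deviations:
  assumes p: "\<forall>i<n. 0 < p i \<and> p i \<le> 1" and T: "T \<subseteq> {..<n}"
    and k: "k \<in> {..<n} - T" and l: "l \<in> {..<n} - T"
  shows "measure_pmf.expectation (random_subset n p)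
      (\<lambda>S. (\<Prod>i\<in>T. sample_weight p S i) * ((sample_weight p S k - 1) * (sample_weight p S l - 1)))
    = (if k = l then 1 / p k - 1 else 0)"
proof -
  let ?D = "random_subset n p"
  let ?w = "sample_weight p"
  have fin: "finite T" using T finite_subset by blast
  have E: "measure_pmf.expectation ?D (\<lambda>S. \<Prod>i\<in>T'. ?w S i) = 1" if "T' \<subseteq> {..<n}" for T'
    using expectation_prod_sample_weight[OF p that] by blast
  show ?thesis
  proof (cases "k = l")
    case True
    have "(\<Prod>i\<in>T. ?w S i) * ((?w S k - 1) * (?w S l - 1))
        = (1 / p k - 2) * (\<Prod>i\<in>insert k T. ?w S i) + (\<Prod>i\<in>T. ?w S i)" for S
    proof -
      \<comment> \<open>The weight takes only the values 0 and \<open>1 / p k\<close>, so its square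
        is \<open>1 / p k\<close> times itself.\<close>
      have sq: "(?w S k - 1) * (?w S k - 1) = (1 / p k - 2) * ?w S k + 1"
        by (simp add: sample_weight_def algebra_simps)
      have ins: "(\<Prod>i\<in>insert k T. ?w S i) = ?w S k * (\<Prod>i\<in>T. ?w S i)"
        using fin k by simp
      show ?thesis
        unfolding True[symmetric] sq ins by (simp only: distrib_left mult_1_right ac_simps)
    qed
    then show ?thesis
      using True k T by (simp add: E integrable_random_subset del: prod.insert_if prod.insert)
  next
    case False
    have "(\<Prod>i\<in>T. ?w S i) * ((?w S k - 1) * (?w S l - 1))
        = (\<Prod>i\<in>insert k (insert l T). ?w S i) - (\<Prod>i\<in>insert k T. ?w S i)
          - (\<Prod>i\<in>insert l T. ?w S i) + (\<Prod>i\<in>T. ?w S i)" for S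
      using fin k l False by (simp add: algebra_simps)
    then show ?thesis
      using False k l T by (simp add: E integrable_random_subset del: prod.insert_if prod.insert)
  qed
qed

lemma expectation_weighted_square_deviation:
  assumes p: "\<forall>i<n. 0 < p i \<and> p i \<le> 1" and T: "T \<subseteq> {..<n}" and U: "U \<subseteq> {..<n} - T"
  shows "measure_pmf.expectation (random_subset n p)
      (\<lambda>S. (\<Prod>i\<in>T. sample_weight p S i) * (\<Sum>k\<in>U. a k * (sample_weight p S k - 1))\<^sup>2)
    = (\<Sum>k\<in>U. (a k)\<^sup>2 * (1 / p k - 1))"
proof -
  let ?w = "sample_weight p"
  have fin: "finite U" using U finite_subset by blast
  have "(\<Prod>i\<in>T. ?w S i) * (\<Sum>k\<in>U. a k * (?w S k - 1))\<^sup>2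
      = (\<Sum>k\<in>U. \<Sum>l\<in>U. (a k * a l) * ((\<Prod>i\<in>T. ?w S i) * ((?w S k - 1) * (?w S l - 1))))" for S
    unfolding power2_eq_square sum_product unfolding sum_distrib_left
    by (intro sum.cong refl) (simp only: ac_simps)
  then have "measure_pmf.expectation (random_subset n p)
      (\<lambda>S. (\<Prod>i\<in>T. ?w S i) * (\<Sum>k\<in>U. a k * (?w S k - 1))\<^sup>2)
    = (\<Sum>k\<in>U. \<Sum>l\<in>U. (a k * a l) * measure_pmf.expectation (random_subset n p)
        (\<lambda>S. (\<Prod>i\<in>T. ?w S i) * ((?w S k - 1) * (?w S l - 1))))"
    by (simp add: integrable_random_subset)
  also have "\<dots> = (\<Sum>k\<in>U. \<Sum>l\<in>U. if l = k then (a k)\<^sup>2 * (1 / p k - 1) else 0)"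
  proof (intro sum.cong refl)
    fix k l assume "k \<in> U" "l \<in> U"
    then have kl: "k \<in> {..<n} - T" "l \<in> {..<n} - T" using U by auto
    show "(a k * a l) * measure_pmf.expectation (random_subset n p)
        (\<lambda>S. (\<Prod>i\<in>T. ?w S i) * ((?w S k - 1) * (?w S l - 1)))
      = (if l = k then (a k)\<^sup>2 * (1 / p k - 1) else 0)"
      unfolding expectation_sample_weight_deviations[OF p T kl] by (cases "l = k") (simp_all add: power2_eq_square)
  qed
  also have "\<dots> = (\<Sum>k\<in>U. (a k)\<^sup>2 * (1 / p k - 1))"
    using fin by simp
  finally show ?thesis .
qed

text \<open>
  The \<open>(i, j)\<close> entry of \<open>G W G - G G\<close> for \<open>W = diag w\<close>. As \<open>G\<close> has zero diagonal, it does not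
  depend on whether \<open>i\<close> and \<open>j\<close> are sampled.
\<close>

definition gram_deviation :: "nat \<Rightarrow> (nat \<Rightarrow> nat \<Rightarrow> real) \<Rightarrow> (nat \<Rightarrow> real) \<Rightarrow> nat set \<Rightarrow> nat \<Rightarrow> nat \<Rightarrow> real"
  where "gram_deviation n G p S i j = (\<Sum>k<n. G i k * G k j * (sample_weight p S k - 1))"

text \<open>The weights 1, \<open>w j\<close> and \<open>w i * w j\<close> turn the squared Gram
  deviations into the squared Frobenius norms of the three errors handled by
  \<open>frobenius_outer\<close>, \<open>frobenius_intertwining\<close> and
  \<open>frobenius_inner\<close>.\<close>

definition total_deviation :: "nat \<Rightarrow> (nat \<Rightarrow> nat \<Rightarrow> real) \<Rightarrow> (nat \<Rightarrow> real) \<Rightarrow> nat set \<Rightarrow> real" where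
  "total_deviation n G p S = (\<Sum>i<n. \<Sum>j<n.
     (1 + sample_weight p S j + sample_weight p S i * sample_weight p S j)
       * (gram_deviation n G p S i j)\<^sup>2)"

text \<open>The variance of \<open>gram_deviation\<close> at \<open>(i, j)\<close> is
  \<open>V i j\<close>. With zero diagonal it involves only weights outside \<open>{i, j}\<close>,
  so the prefactors average out to 1 and each of the three terms contributes \<open>V i j\<close>.
  Only on the diagonal is a weight squared, which adds \<open>V i i / p i\<close>.\<close>

lemma expectation_total_deviation_le:
  assumes p: "\<forall>i<n. 0 < p i \<and> p i \<le> 1" and G: "\<And>i. G i i = 0"
  defines "V \<equiv> \<lambda>i j. \<Sum>k<n. (G i k * G k j)\<^sup>2 * (1 / p k - 1)"
  shows "measure_pmf.expectation (random_subset n p) (total_deviation n G p)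
    \<le> 3 * (\<Sum>i<n. \<Sum>j<n. V i j) + (\<Sum>i<n. V i i / p i)"
proof -
  let ?w = "sample_weight p"
  let ?D = "random_subset n p"
  let ?X = "gram_deviation n G p"
  have E: "measure_pmf.expectation ?D (\<lambda>S. (\<Prod>i\<in>T. ?w S i) * (?X S i j)\<^sup>2) = V i j"
    if "T \<subseteq> {i, j}" "i < n" "j < n" for T i j
  proof -
    have X: "?X S i j = (\<Sum>k\<in>{..<n} - {i, j}. G i k * G k j * (?w S k - 1))" for S
      unfolding gram_deviation_def by (intro sum.mono_neutral_right) (auto simp: G)
    have V: "V i j = (\<Sum>k\<in>{..<n} - {i, j}. (G i k * G k j)\<^sup>2 * (1 / p k - 1))"
      unfolding V_def by (intro sum.mono_neutral_right) (auto simp: G)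
    show ?thesis
      unfolding X V by (rule expectation_weighted_square_deviation[OF p]) (use that in auto)
  qed
  have V0: "0 \<le> V i j" for i j
    unfolding V_def using p by (intro sum_nonneg mult_nonneg_nonneg) (auto simp: field_simps)
  have ij: "measure_pmf.expectation ?D (\<lambda>S. (1 + ?w S j + ?w S i * ?w S j) * (?X S i j)\<^sup>2)
      \<le> 3 * V i j + (if j = i then V i i / p i else 0)" if "i < n" "j < n" for i j
  proof (cases "i = j")
    case False
    have "(1 + ?w S j + ?w S i * ?w S j) * (?X S i j)\<^sup>2 = (\<Prod>i\<in>{}. ?w S i) * (?X S i j)\<^sup>2
        + (\<Prod>i\<in>{j}. ?w S i) * (?X S i j)\<^sup>2 + (\<Prod>i\<in>{i, j}. ?w S i) * (?X S i j)\<^sup>2" for S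
      using False by (simp add: algebra_simps)
    then have "measure_pmf.expectation ?D (\<lambda>S. (1 + ?w S j + ?w S i * ?w S j) * (?X S i j)\<^sup>2)
        = V i j + V i j + V i j"
      using E[of "{}" i j] E[of "{j}" i j] E[of "{i, j}" i j] that
      by (simp only: Bochner_Integration.integral_add integrable_random_subset) simp
    then show ?thesis using False by simp
  next
    case True
    \<comment> \<open>For \<open>i = j\<close> the squared weight equals \<open>1 / p j\<close>
      times the weight.\<close>
    have "(1 + ?w S j + ?w S i * ?w S j) * (?X S i j)\<^sup>2 = (\<Prod>i\<in>{}. ?w S i) * (?X S i j)\<^sup>2
        + (1 + 1 / p j) * ((\<Prod>i\<in>{j}. ?w S i) * (?X S i j)\<^sup>2)" for S
      using True by (auto simp: sample_weight_def algebra_simps)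
    then have "measure_pmf.expectation ?D (\<lambda>S. (1 + ?w S j + ?w S i * ?w S j) * (?X S i j)\<^sup>2)
        = V i j + (1 + 1 / p j) * V i j"
      using E[of "{}" i j] E[of "{j}" i j] that
      by (simp only: Bochner_Integration.integral_add Bochner_Integration.integral_mult_right_zero
          integrable_random_subset) simp
    then show ?thesis
      using True V0[of j j] by (simp add: algebra_simps)
  qed
  have "measure_pmf.expectation ?D (total_deviation n G p)
      = (\<Sum>i<n. \<Sum>j<n. measure_pmf.expectation ?D
          (\<lambda>S. (1 + ?w S j + ?w S i * ?w S j) * (?X S i j)\<^sup>2))"
    unfolding total_deviation_def by (simp add: integrable_random_subset)
  also have "\<dots> \<le> (\<Sum>i<n. \<Sum>j<n. 3 * V i j + (if j = i then V i i / p i else 0))"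
    using ij by (intro sum_mono) auto
  also have "\<dots> = 3 * (\<Sum>i<n. \<Sum>j<n. V i j) + (\<Sum>i<n. V i i / p i)"
    by (simp add: sum.distrib sum_distrib_left)
  finally show ?thesis .
qed

lemma prob_random_subset_ge_of_expectation:
  assumes nonneg: "\<And>S. 0 \<le> f S"
    and E: "measure_pmf.expectation (random_subset n p) f \<le> \<delta> * b" and b: "0 < b"
    and Q: "\<And>S. S \<subseteq> {..<n} \<Longrightarrow> f S < b \<Longrightarrow> S \<in> Q"
  shows "1 - \<delta> \<le> measure_pmf.prob (random_subset n p) Q"
proof -
  let ?D = "random_subset n p"
  have "measure_pmf.prob ?D {S. b \<le> f S} \<le> measure_pmf.expectation ?D f / b"
    using integral_Markov_inequality_measure[of "measure_pmf ?D" f "{}" b] nonneg b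
    by (simp add: integrable_random_subset)
  also have "\<dots> \<le> \<delta>"
    using E b by (simp add: divide_le_eq)
  finally have "1 - \<delta> \<le> 1 - measure_pmf.prob ?D {S. b \<le> f S}"
    by simp
  also have "\<dots> = measure_pmf.prob ?D (- {S. b \<le> f S})"
    using measure_pmf.prob_compl[of "{S. b \<le> f S}" ?D] by (simp add: Compl_eq_Diff_UNIV)
  \<comment> \<open>The inclusion in \<open>Q\<close> is known only for subsets of
    \<open>{..<n}\<close>, hence almost surely.\<close>
  also have "\<dots> \<le> measure_pmf.prob ?D Q"
    by (rule measure_pmf.finite_measure_mono_AE)
      (auto intro!: AE_pmfI Q dest: set_random_subset)
  finally show ?thesis .
qed

section \<open>The sampled matrix as an approximate compression\<close>

lemma bij_betw_pick:
  assumes "finite S"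
  shows "bij_betw (pick S) {..<card S} S"
proof -
  have "inj_on (pick S) {..<card S}"
    by (rule linorder_inj_onI) (auto dest: pick_mono_le[of _ S])
  moreover have "pick S ` {..<card S} \<subseteq> S"
    using pick_in_set_le by auto
  ultimately show ?thesis
    using assms by (simp add: bij_betw_def card_image card_subset_eq)
qed

lemma sum_pick:
  assumes "finite S"
  shows "(\<Sum>a<card S. f (pick S a)) = (\<Sum>l\<in>S. f l)"
  by (rule sum.reindex_bij_betw[OF bij_betw_pick[OF assms]])

text \<open>The dictionary between positions in the sampled matrices and full index sums with random
  weights.\<close>

lemma sum_pick_weight:
  fixes f :: "nat \<Rightarrow> real"
  assumes S: "S \<subseteq> {..<n}"
  shows "(\<Sum>a<card S. f (pick S a) / p (pick S a)) = (\<Sum>l<n. f l * sample_weight p S l)"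
proof -
  have "finite S" using S finite_subset by blast
  then have "(\<Sum>a<card S. f (pick S a) / p (pick S a)) = (\<Sum>l\<in>S. f l / p l)"
    by (rule sum_pick)
  also have "\<dots> = (\<Sum>l\<in>S. f l * sample_weight p S l)"
    by (intro sum.cong) (auto simp: sample_weight_def)
  also have "\<dots> = (\<Sum>l<n. f l * sample_weight p S l)"
    using S by (intro sum.mono_neutral_left) (auto simp: sample_weight_def)
  finally show ?thesis .
qed

context
  fixes n :: nat and G :: "nat \<Rightarrow> nat \<Rightarrow> real" and p :: "nat \<Rightarrow> real" and S :: "nat set"
begin

definition full_mat :: "real mat" where
  "full_mat = mat n n (\<lambda>(i, j). G i j)"

definition compression_mat :: "real mat" where
  "compression_mat = mat n (card S) (\<lambda>(i, a). G i (pick S a) / sqrt (p (pick S a)))"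

definition sampled_mat :: "real mat" where
  "sampled_mat = mat (card S) (card S)
     (\<lambda>(a, b). G (pick S a) (pick S b) / sqrt (p (pick S a) * p (pick S b)))"

context
  assumes S: "S \<subseteq> {..<n}" and sym: "\<And>i j. G i j = G j i" and p: "\<forall>i<n. 0 < p i \<and> p i \<le> 1"
begin

lemma pick_props:
  assumes "a < card S"
  shows "pick S a < n" "0 < p (pick S a)"
  using pick_in_set_le[OF assms] S p by auto

lemma sample_weight_nonneg: "0 \<le> sample_weight p S i"
  using S p by (auto simp: sample_weight_def intro: less_imp_le)

lemma weighted_deviation_le_total:
  assumes "\<And>i j. i < n \<Longrightarrow> j < n \<Longrightarrow>
    c i j \<in> {1, sample_weight p S j, sample_weight p S i * sample_weight p S j}"
  shows "(\<Sum>i<n. \<Sum>j<n. c i j * (gram_deviation n G p S i j)\<^sup>2) \<le> total_deviation n G p S"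
  unfolding total_deviation_def
proof (intro sum_mono mult_right_mono)
  fix i j assume "i \<in> {..<n}" "j \<in> {..<n}"
  then show "c i j \<le> 1 + sample_weight p S j + sample_weight p S i * sample_weight p S j"
    using assms[of i j] sample_weight_nonneg[of i] sample_weight_nonneg[of j] by auto
qed simp

text \<open>In matrix terms \<open>K K^T = G W G\<close>, so the entries of the difference are
  exactly the Gram deviations.\<close>

lemma frobenius_outer:
  "frobenius_sq (compression_mat * compression_mat\<^sup>T - full_mat * full_mat) \<le> total_deviation n G p S"
proof -
  have entry: "(compression_mat * compression_mat\<^sup>T - full_mat * full_mat) $$ (i, j)
      = gram_deviation n G p S i j" if "i < n" "j < n" for i j
  proof -
    have "(compression_mat * compression_mat\<^sup>T) $$ (i, j)
        = (\<Sum>a<card S. G i (pick S a) / sqrt (p (pick S a)) * (G j (pick S a) / sqrt (p (pick S a))))"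
      using that by (simp add: compression_mat_def scalar_prod_def lessThan_atLeast0)
    also have "\<dots> = (\<Sum>a<card S. (G i (pick S a) * G (pick S a) j) / p (pick S a))"
      using pick_props(2) by (intro sum.cong) (auto simp: sym less_imp_le)
    also have "\<dots> = (\<Sum>l<n. G i l * G l j * sample_weight p S l)"
      by (rule sum_pick_weight[OF S])
    finally show ?thesis
      using that by (simp add: compression_mat_def full_mat_def gram_deviation_def scalar_prod_def
          lessThan_atLeast0 right_diff_distrib sum_subtractf)
  qed
  have "frobenius_sq (compression_mat * compression_mat\<^sup>T - full_mat * full_mat)
      = (\<Sum>i<n. \<Sum>j<n. 1 * (gram_deviation n G p S i j)\<^sup>2)"
    unfolding frobenius_sq_def using entry by (simp add: full_mat_def)
  also have "\<dots> \<le> total_deviation n G p S"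
    by (rule weighted_deviation_le_total) simp
  finally show ?thesis .
qed

text \<open>Here \<open>G K - K M = - (G W G - G G) W^(1/2)\<close> on the sampled columns; squaring
  turns the column scaling into the weight of \<open>j\<close>.\<close>

lemma frobenius_intertwining:
  "frobenius_sq (full_mat * compression_mat - compression_mat * sampled_mat) \<le> total_deviation n G p S"
proof -
  have entry: "(full_mat * compression_mat - compression_mat * sampled_mat) $$ (i, a)
      = - gram_deviation n G p S i (pick S a) / sqrt (p (pick S a))"
    if "i < n" "a < card S" for i a
  proof -
    let ?q = "pick S a"
    have "(compression_mat * sampled_mat) $$ (i, a)
        = (\<Sum>b<card S. G i (pick S b) / sqrt (p (pick S b))
            * (G (pick S b) ?q / sqrt (p (pick S b) * p ?q)))"
      using that by (simp add: compression_mat_def sampled_mat_def scalar_prod_def lessThan_atLeast0)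
    also have "\<dots> = (\<Sum>b<card S. (G i (pick S b) * G (pick S b) ?q) / p (pick S b)) / sqrt (p ?q)"
      unfolding sum_divide_distrib
      using pick_props(2) by (intro sum.cong) (auto simp: real_sqrt_mult less_imp_le)
    also have "\<dots> = (\<Sum>l<n. G i l * G l ?q * sample_weight p S l) / sqrt (p ?q)"
      by (subst sum_pick_weight[OF S]) simp
    finally have KM: "(compression_mat * sampled_mat) $$ (i, a) = \<dots>" .
    have GK: "(full_mat * compression_mat) $$ (i, a) = (\<Sum>l<n. G i l * G l ?q) / sqrt (p ?q)"
      unfolding sum_divide_distrib
      using that by (simp add: compression_mat_def full_mat_def scalar_prod_def lessThan_atLeast0)
    have "(full_mat * compression_mat - compression_mat * sampled_mat) $$ (i, a)
        = (full_mat * compression_mat) $$ (i, a) - (compression_mat * sampled_mat) $$ (i, a)"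
      using that by (simp add: compression_mat_def full_mat_def sampled_mat_def)
    then show ?thesis
      unfolding KM GK gram_deviation_def
      by (simp add: right_diff_distrib sum_subtractf diff_divide_distrib)
  qed
  have "frobenius_sq (full_mat * compression_mat - compression_mat * sampled_mat)
      = (\<Sum>i<n. \<Sum>a<card S. (gram_deviation n G p S i (pick S a))\<^sup>2 / p (pick S a))"
    unfolding frobenius_sq_def using entry pick_props(2)
    by (auto simp: compression_mat_def sampled_mat_def power_divide less_imp_le intro!: sum.cong)
  also have "\<dots> = (\<Sum>i<n. \<Sum>j<n. sample_weight p S j * (gram_deviation n G p S i j)\<^sup>2)"
    by (subst sum_pick_weight[OF S]) (simp add: mult.commute)
  also have "\<dots> \<le> total_deviation n G p S"
    by (rule weighted_deviation_le_total) simp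
  finally show ?thesis .
qed

text \<open>Here \<open>K^T K - M M = - W^(1/2) (G W G - G G) W^(1/2)\<close> on the sample, so both
  the row and the column scaling become weights.\<close>

lemma frobenius_inner:
  "frobenius_sq (compression_mat\<^sup>T * compression_mat - sampled_mat * sampled_mat)
    \<le> total_deviation n G p S"
proof -
  have entry: "(compression_mat\<^sup>T * compression_mat - sampled_mat * sampled_mat) $$ (a, b)
      = - gram_deviation n G p S (pick S a) (pick S b) / sqrt (p (pick S a) * p (pick S b))"
    if "a < card S" "b < card S" for a b
  proof -
    let ?q = "pick S a" and ?r = "pick S b"
    have "(sampled_mat * sampled_mat) $$ (a, b)
        = (\<Sum>c<card S. G ?q (pick S c) / sqrt (p ?q * p (pick S c))
            * (G (pick S c) ?r / sqrt (p (pick S c) * p ?r)))"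
      using that by (simp add: sampled_mat_def scalar_prod_def lessThan_atLeast0)
    also have "\<dots> = (\<Sum>c<card S. (G ?q (pick S c) * G (pick S c) ?r) / p (pick S c)) / sqrt (p ?q * p ?r)"
      unfolding sum_divide_distrib
      using pick_props(2) by (intro sum.cong) (auto simp: real_sqrt_mult less_imp_le)
    also have "\<dots> = (\<Sum>l<n. G ?q l * G l ?r * sample_weight p S l) / sqrt (p ?q * p ?r)"
      by (subst sum_pick_weight[OF S]) simp
    finally have MM: "(sampled_mat * sampled_mat) $$ (a, b) = \<dots>" .
    have KK: "(compression_mat\<^sup>T * compression_mat) $$ (a, b)
        = (\<Sum>l<n. G ?q l * G l ?r) / sqrt (p ?q * p ?r)"
      unfolding sum_divide_distrib
      using that by (simp add: compression_mat_def scalar_prod_def lessThan_atLeast0 real_sqrt_mult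
          sym[of ?q])
    have "(compression_mat\<^sup>T * compression_mat - sampled_mat * sampled_mat) $$ (a, b)
        = (compression_mat\<^sup>T * compression_mat) $$ (a, b) - (sampled_mat * sampled_mat) $$ (a, b)"
      using that by (simp add: compression_mat_def sampled_mat_def)
    then show ?thesis
      unfolding MM KK gram_deviation_def
      by (simp add: right_diff_distrib sum_subtractf diff_divide_distrib)
  qed
  have "frobenius_sq (compression_mat\<^sup>T * compression_mat - sampled_mat * sampled_mat)
      = (\<Sum>a<card S. (\<Sum>b<card S. (gram_deviation n G p S (pick S a) (pick S b))\<^sup>2 / p (pick S b))
          / p (pick S a))"
    unfolding frobenius_sq_def sum_divide_distrib using entry pick_props(2)
    by (auto simp: sampled_mat_def power_divide real_sqrt_mult power_mult_distrib less_imp_le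
        intro!: sum.cong)
  also have "\<dots> = (\<Sum>i<n. (\<Sum>j<n. (gram_deviation n G p S i j)\<^sup>2 * sample_weight p S j)
      * sample_weight p S i)"
    by (subst sum_pick_weight[OF S], subst sum_pick_weight[OF S]) simp
  also have "\<dots> = (\<Sum>i<n. \<Sum>j<n. sample_weight p S i * sample_weight p S j
      * (gram_deviation n G p S i j)\<^sup>2)"
    by (simp add: sum_distrib_left sum_distrib_right ac_simps)
  also have "\<dots> \<le> total_deviation n G p S"
    by (rule weighted_deviation_le_total) simp
  finally show ?thesis .
qed

end

end

section \<open>Discarding entries of light rows and columns\<close>

text \<open>Weighted AM-GM: \<open>2 * \<bar>x i * x j\<bar>\<close> is at most
  \<open>(x i)\<^sup>2 * (r j / r i) + (x j)\<^sup>2 * (r i / r j)\<close>. By symmetry of the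
  absolute values both halves sum to the same weighted row sums.\<close>

lemma Schur_test:
  fixes B :: "nat \<Rightarrow> nat \<Rightarrow> real"
  assumes sym: "\<And>i j. \<bar>B i j\<bar> = \<bar>B j i\<bar>" and r: "\<And>i. i < n \<Longrightarrow> 0 < r i"
    and B: "\<And>i. i < n \<Longrightarrow> (\<Sum>j<n. \<bar>B i j\<bar> * r j / r i) \<le> t"
  shows "\<bar>\<Sum>i<n. \<Sum>j<n. x i * B i j * x j\<bar> \<le> t * (\<Sum>i<n. (x i)\<^sup>2)"
proof -
  have "\<bar>\<Sum>i<n. \<Sum>j<n. x i * B i j * x j\<bar> \<le> (\<Sum>i<n. \<Sum>j<n. \<bar>x i * B i j * x j\<bar>)"
    by (rule order_trans[OF sum_abs sum_mono[OF sum_abs]])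
  also have "\<dots> \<le> (\<Sum>i<n. \<Sum>j<n. ((x i)\<^sup>2 * (\<bar>B i j\<bar> * r j / r i) + (x j)\<^sup>2 * (\<bar>B j i\<bar> * r i / r j)) / 2)"
  proof (intro sum_mono)
    fix i j assume "i \<in> {..<n}" "j \<in> {..<n}"
    then have ri: "0 < r i" and rj: "0 < r j" using r by auto
    define u where "u = sqrt (r j / r i)"
    have u: "0 < u" "u\<^sup>2 = r j / r i" "(1 / u)\<^sup>2 = r i / r j"
      using ri rj by (auto simp: u_def power_divide)
    have "2 * ((\<bar>x i\<bar> * u) * (\<bar>x j\<bar> * (1 / u))) \<le> (\<bar>x i\<bar> * u)\<^sup>2 + (\<bar>x j\<bar> * (1 / u))\<^sup>2"
      using sum_squares_bound[of "\<bar>x i\<bar> * u" "\<bar>x j\<bar> * (1 / u)"] by (simp only: mult.assoc)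
    then have "2 * (\<bar>x i\<bar> * \<bar>x j\<bar>) \<le> (x i)\<^sup>2 * (r j / r i) + (x j)\<^sup>2 * (r i / r j)"
      unfolding power_mult_distrib u using u(1) by simp
    then have "\<bar>B i j\<bar> * (2 * (\<bar>x i\<bar> * \<bar>x j\<bar>))
        \<le> \<bar>B i j\<bar> * ((x i)\<^sup>2 * (r j / r i) + (x j)\<^sup>2 * (r i / r j))"
      by (intro mult_left_mono) auto
    then show "\<bar>x i * B i j * x j\<bar>
        \<le> ((x i)\<^sup>2 * (\<bar>B i j\<bar> * r j / r i) + (x j)\<^sup>2 * (\<bar>B j i\<bar> * r i / r j)) / 2"
      unfolding sym[of j i] by (simp add: abs_mult algebra_simps)
  qed
  also have "\<dots> = (\<Sum>i<n. (x i)\<^sup>2 * (\<Sum>j<n. \<bar>B i j\<bar> * r j / r i))"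
  proof -
    have "(\<Sum>i<n. \<Sum>j<n. (x j)\<^sup>2 * (\<bar>B j i\<bar> * r i / r j))
        = (\<Sum>i<n. \<Sum>j<n. (x i)\<^sup>2 * (\<bar>B i j\<bar> * r j / r i))"
      by (rule sum.swap)
    moreover have "(\<Sum>i<n. \<Sum>j<n. (P i j + Q i j) / 2)
        = ((\<Sum>i<n. \<Sum>j<n. P i j) + (\<Sum>i<n. \<Sum>j<n. Q i j)) / 2" for P Q :: "nat \<Rightarrow> nat \<Rightarrow> real"
      by (simp only: sum.distrib sum_divide_distrib[symmetric])
    ultimately show ?thesis
      by (simp only: sum_distrib_left) simp
  qed
  also have "\<dots> \<le> (\<Sum>i<n. (x i)\<^sup>2 * t)"
    using B by (intro sum_mono mult_left_mono) auto
  also have "\<dots> = t * (\<Sum>i<n. (x i)\<^sup>2)"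
    by (simp add: sum_distrib_left mult.commute)
  finally show ?thesis .
qed

text \<open>The value \<open>0\<close> outside the matrix makes the function symmetric for all arguments.\<close>

definition thresholded :: "real \<Rightarrow> (nat \<Rightarrow> real) \<Rightarrow> real mat \<Rightarrow> nat \<Rightarrow> nat \<Rightarrow> real" where
  "thresholded \<tau> d A i j = (if i = j \<or> d i * d j < \<tau> \<or> dim_row A \<le> max i j then 0 else A $$ (i, j))"

text \<open>The diagonal costs at most 1. For the light entries \<open>B\<close>, the Schur test
  with weights \<open>sqrt (d i)\<close> bounds each entry's share of row \<open>i\<close> by
  \<open>sqrt (d i * d j) / d i \<le> sqrt \<tau> / d i\<close>, and the row has at most
  \<open>d i\<close> nonzero entries.\<close>

lemma thresholded_quadratic_form:
  fixes A :: "real mat"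
  assumes A: "A \<in> carrier_mat n n" "A\<^sup>T = A" and le1: "\<And>i j. i < n \<Longrightarrow> j < n \<Longrightarrow> \<bar>A $$ (i, j)\<bar> \<le> 1"
    and d: "\<And>i. i < n \<Longrightarrow> 0 < d i"
    and nnz: "\<And>i. i < n \<Longrightarrow> real (card {j. j < n \<and> A $$ (i, j) \<noteq> 0}) \<le> d i"
    and \<tau>: "0 \<le> \<tau>" and x: "x \<in> carrier_vec n"
  shows "\<bar>x \<bullet> (A *\<^sub>v x) - x \<bullet> (full_mat n (thresholded \<tau> d A) *\<^sub>v x)\<bar> \<le> (1 + sqrt \<tau>) * (x \<bullet> x)"
proof -
  let ?G = "thresholded \<tau> d A"
  define B where "B i j = (if i < n \<and> j < n \<and> i \<noteq> j \<and> d i * d j < \<tau> then A $$ (i, j) else 0)" for i j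
  have form: "x \<bullet> (M *\<^sub>v x) = (\<Sum>i<n. \<Sum>j<n. x $ i * M $$ (i, j) * x $ j)"
    if M: "M \<in> carrier_mat n n" for M
  proof -
    have "x \<bullet> (M *\<^sub>v x) = (\<Sum>i<n. x $ i * (\<Sum>j<n. M $$ (i, j) * x $ j))"
      using M x by (subst scalar_prod_sum[of _ n]) (auto simp: scalar_prod_sum[OF x] intro!: sum.cong)
    then show ?thesis
      by (simp add: sum_distrib_left mult.assoc)
  qed
  have Asym: "A $$ (i, j) = A $$ (j, i)" if "i < n" "j < n" for i j
    using that A by (metis carrier_matD index_transpose_mat(1))
  have "x \<bullet> (A *\<^sub>v x) - x \<bullet> (full_mat n ?G *\<^sub>v x)
      = (\<Sum>i<n. \<Sum>j<n. x $ i * A $$ (i, j) * x $ j) - (\<Sum>i<n. \<Sum>j<n. x $ i * ?G i j * x $ j)"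
    using form[OF A(1)] form[of "full_mat n ?G"] by (simp add: full_mat_def)
  also have "\<dots> = (\<Sum>i<n. \<Sum>j<n. x $ i * B i j * x $ j + (if j = i then A $$ (i, i) * (x $ i)\<^sup>2 else 0))"
    unfolding sum_subtractf[symmetric]
    using A(1) by (intro sum.cong refl) (auto simp: B_def thresholded_def power2_eq_square)
  also have "\<dots> = (\<Sum>i<n. \<Sum>j<n. x $ i * B i j * x $ j) + (\<Sum>i<n. A $$ (i, i) * (x $ i)\<^sup>2)"
    by (simp add: sum.distrib)
  finally have eq: "x \<bullet> (A *\<^sub>v x) - x \<bullet> (full_mat n ?G *\<^sub>v x) = \<dots>" .
  have "\<bar>\<Sum>i<n. A $$ (i, i) * (x $ i)\<^sup>2\<bar> \<le> (\<Sum>i<n. \<bar>A $$ (i, i) * (x $ i)\<^sup>2\<bar>)"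
    by (rule sum_abs)
  also have "\<dots> \<le> (\<Sum>i<n. 1 * (x $ i)\<^sup>2)"
    unfolding abs_mult using le1 by (intro sum_mono mult_mono) auto
  finally have diag: "\<bar>\<Sum>i<n. A $$ (i, i) * (x $ i)\<^sup>2\<bar> \<le> (\<Sum>i<n. (x $ i)\<^sup>2)" by simp
  have off: "\<bar>\<Sum>i<n. \<Sum>j<n. x $ i * B i j * x $ j\<bar> \<le> sqrt \<tau> * (\<Sum>i<n. (x $ i)\<^sup>2)"
  proof (rule Schur_test[where r = "\<lambda>i. sqrt (d i)"])
    show "\<bar>B i j\<bar> = \<bar>B j i\<bar>" for i j
      using Asym[of i j] by (auto simp: B_def mult.commute)
    show "0 < sqrt (d i)" if "i < n" for i
      using d that by simp
    fix i assume i: "i < n"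
    have "(\<Sum>j<n. \<bar>B i j\<bar> * sqrt (d j) / sqrt (d i))
        = (\<Sum>j | j < n \<and> A $$ (i, j) \<noteq> 0. \<bar>B i j\<bar> * sqrt (d j) / sqrt (d i))"
      by (intro sum.mono_neutral_right) (auto simp: B_def)
    also have "\<dots> \<le> (\<Sum>j | j < n \<and> A $$ (i, j) \<noteq> 0. sqrt \<tau> / d i)"
    proof (intro sum_mono)
      fix j assume "j \<in> {j. j < n \<and> A $$ (i, j) \<noteq> 0}"
      then have j: "j < n" by simp
      show "\<bar>B i j\<bar> * sqrt (d j) / sqrt (d i) \<le> sqrt \<tau> / d i"
      proof (cases "d i * d j < \<tau>")
        case True
        have "\<bar>B i j\<bar> * sqrt (d j) / sqrt (d i) \<le> 1 * sqrt (d j) / sqrt (d i)"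
          using le1[OF i j] d[OF i] d[OF j] by (intro divide_right_mono mult_right_mono) (auto simp: B_def)
        also have "\<dots> = sqrt (d i * d j) / d i"
          using d[OF i] by (simp add: real_sqrt_mult field_simps)
        also have "\<dots> \<le> sqrt \<tau> / d i"
          using True d[OF i] by (intro divide_right_mono) auto
        finally show ?thesis .
      qed (use \<tau> d[OF i] in \<open>simp add: B_def\<close>)
    qed
    also have "\<dots> = real (card {j. j < n \<and> A $$ (i, j) \<noteq> 0}) * (sqrt \<tau> / d i)"
      by simp
    also have "\<dots> \<le> d i * (sqrt \<tau> / d i)"
      using nnz[OF i] \<tau> d[OF i] by (intro mult_right_mono) auto
    also have "\<dots> = sqrt \<tau>"
      using d[OF i] by simp
    finally show "(\<Sum>j<n. \<bar>B i j\<bar> * sqrt (d j) / sqrt (d i)) \<le> sqrt \<tau>" .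
  qed
  have xx: "x \<bullet> x = (\<Sum>i<n. (x $ i)\<^sup>2)"
    by (simp add: scalar_prod_sum[OF x] power2_eq_square)
  show ?thesis
    unfolding eq xx using diag off by (simp add: distrib_right)
qed

section \<open>The expected deviation\<close>

text \<open>
  The threshold \<open>\<tau>\<close> is only needed for \<open>V i i / p i\<close>: there the product of two inverse
  probabilities appears, which \<open>d i \<ge> 1\<close> alone does not control.
\<close>

lemma deviation_variance_bound:
  fixes G :: "nat \<Rightarrow> nat \<Rightarrow> real" and s N \<tau> :: real
  assumes d: "\<And>i. i < n \<Longrightarrow> 1 \<le> d i" and N: "N = (\<Sum>i<n. d i)" "0 < N" and s: "0 < s"
    and sym: "\<And>i j. G i j = G j i"
    and G1: "\<And>i j. i < n \<Longrightarrow> j < n \<Longrightarrow> (G i j)\<^sup>2 \<le> 1"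
    and row: "\<And>i. i < n \<Longrightarrow> (\<Sum>j<n. (G i j)\<^sup>2) \<le> d i"
    and thr: "\<And>i j. G i j \<noteq> 0 \<Longrightarrow> \<tau> \<le> d i * d j" and \<tau>: "0 < \<tau>" "N \<le> s * \<tau>"
    and p: "\<And>i. i < n \<Longrightarrow> p i = min 1 (s * d i / N)"
  defines "V \<equiv> \<lambda>i j. \<Sum>k<n. (G i k * G k j)\<^sup>2 * (1 / p k - 1)"
  shows "3 * (\<Sum>i<n. \<Sum>j<n. V i j) + (\<Sum>i<n. V i i / p i) \<le> 5 * N\<^sup>2 / s"
proof -
  \<comment> \<open>With \<open>y = s * d k / N\<close>, the inverse of \<open>min 1 y\<close> is
    \<open>max 1 (1 / y)\<close>, which is at most \<open>1 + 1 / y\<close>.\<close>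
  have inv: "1 / p k \<le> 1 + N / (s * d k)" "1 / p k - 1 \<le> N / (s * d k)" "0 \<le> 1 / p k - 1" "0 < p k"
    if "k < n" for k
  proof -
    have pos: "0 < s * d k / N" using d[OF that] s N by simp
    then show "0 < p k" using p[OF that] by simp
    have "1 / min 1 y = max 1 (1 / y)" if "0 < y" for y :: real
      using that by (cases "1 \<le> y") (auto simp: min_def max_def)
    from this[OF pos] have "1 / p k = max 1 (N / (s * d k))"
      unfolding p[OF that] by simp
    moreover have "0 < N / (s * d k)" using d[OF that] s N(2) by simp
    ultimately show "1 / p k \<le> 1 + N / (s * d k)" "1 / p k - 1 \<le> N / (s * d k)" "0 \<le> 1 / p k - 1"
      by (auto simp: max_def)
  qed
  have row0: "0 \<le> (\<Sum>j<n. (G i j)\<^sup>2)" for i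
    by (simp add: sum_nonneg)
  \<comment> \<open>Grouped by the middle index \<open>k\<close>, the sum over \<open>i\<close> and
    \<open>j\<close> factors into the squared row sum, at most \<open>(d k)\<^sup>2\<close>. The
    variance factor \<open>N / (s * d k)\<close> cancels one \<open>d k\<close>, and the rest sums
    to \<open>N\<^sup>2 / s\<close>.\<close>
  have "(\<Sum>i<n. \<Sum>j<n. V i j)
      = (\<Sum>k<n. (1 / p k - 1) * ((\<Sum>j<n. (G k j)\<^sup>2) * (\<Sum>j<n. (G k j)\<^sup>2)))"
  proof -
    have "(\<Sum>i<n. \<Sum>j<n. V i j) = (\<Sum>i<n. \<Sum>k<n. \<Sum>j<n. (G i k * G k j)\<^sup>2 * (1 / p k - 1))"
      unfolding V_def by (intro sum.cong refl sum.swap)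
    also have "\<dots> = (\<Sum>k<n. \<Sum>i<n. \<Sum>j<n. (G i k * G k j)\<^sup>2 * (1 / p k - 1))"
      by (rule sum.swap)
    also have "\<dots> = (\<Sum>k<n. \<Sum>i<n. \<Sum>j<n. (1 / p k - 1) * ((G k i)\<^sup>2 * (G k j)\<^sup>2))"
      by (simp add: power_mult_distrib sym mult.commute)
    finally show ?thesis
      unfolding sum_product unfolding sum_distrib_left .
  qed
  also have "\<dots> \<le> (\<Sum>k<n. N / s * d k)"
  proof (rule sum_mono)
    fix k assume "k \<in> {..<n}"
    then have k: "k < n" by simp
    have "(1 / p k - 1) * ((\<Sum>j<n. (G k j)\<^sup>2) * (\<Sum>j<n. (G k j)\<^sup>2)) \<le> N / (s * d k) * (d k * d k)"
      using inv[OF k] row[OF k] row0 d[OF k] s N by (intro mult_mono) auto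
    also have "\<dots> = N / s * d k"
      using d[OF k] s by simp
    finally show "(1 / p k - 1) * ((\<Sum>j<n. (G k j)\<^sup>2) * (\<Sum>j<n. (G k j)\<^sup>2)) \<le> N / s * d k" .
  qed
  also have "\<dots> = N\<^sup>2 / s"
    unfolding sum_distrib_left[symmetric] N(1)[symmetric] by (simp add: power2_eq_square)
  finally have off: "(\<Sum>i<n. \<Sum>j<n. V i j) \<le> N\<^sup>2 / s" .
  have "(\<Sum>i<n. V i i / p i) = (\<Sum>i<n. \<Sum>k<n. (G i k * G k i)\<^sup>2 * (1 / p k - 1) / p i)"
    unfolding V_def by (simp add: sum_divide_distrib)
  also have "\<dots> \<le> (\<Sum>i<n. \<Sum>k<n. (G i k)\<^sup>2 * (2 * N / s))"
  proof (intro sum_mono)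
    fix i k assume "i \<in> {..<n}" "k \<in> {..<n}"
    then have i: "i < n" and k: "k < n" by auto
    show "(G i k * G k i)\<^sup>2 * (1 / p k - 1) / p i \<le> (G i k)\<^sup>2 * (2 * N / s)"
    proof (cases "G i k = 0")
      case False
      have dd: "\<tau> \<le> d i * d k" using thr[OF False] .
      \<comment> \<open>After expansion, the first term is bounded by \<open>d k \<ge> 1\<close>,
        the second by \<open>N \<le> s * \<tau> \<le> s * (d i * d k)\<close>, valid because the
        surviving entry belongs to a heavy pair.\<close>
      have "(1 / p k - 1) * (1 / p i) \<le> N / (s * d k) * (1 + N / (s * d i))"
        using inv[OF k] inv[OF i] d[OF k] s N by (intro mult_mono) auto
      also have "\<dots> = N / s * (1 / d k) + N / s * (N / (s * (d i * d k)))"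
        using d[OF i] d[OF k] s by (simp add: field_simps)
      also have "\<dots> \<le> N / s * 1 + N / s * 1"
      proof (intro add_mono mult_left_mono)
        show "1 / d k \<le> 1" using d[OF k] by simp
        have "N \<le> s * (d i * d k)"
          using \<tau>(2) mult_left_mono[OF dd, of s] s by linarith
        then show "N / (s * (d i * d k)) \<le> 1"
          using N by simp
      qed (use s N in auto)
      finally have le: "(1 / p k - 1) * (1 / p i) \<le> 2 * N / s" by simp
      have "(G i k * G k i)\<^sup>2 * (1 / p k - 1) / p i = (G i k)\<^sup>2 * ((G i k)\<^sup>2 * ((1 / p k - 1) * (1 / p i)))"
        by (simp add: power_mult_distrib sym[of k i])
      also have "\<dots> \<le> (G i k)\<^sup>2 * (1 * (2 * N / s))"
        using le G1[OF i k] inv[OF k] inv[OF i] by (intro mult_left_mono mult_mono) auto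
      finally show ?thesis by simp
    qed simp
  qed
  also have "\<dots> = (\<Sum>i<n. \<Sum>k<n. (G i k)\<^sup>2) * (2 * N / s)"
    unfolding sum_distrib_right ..
  also have "\<dots> \<le> N * (2 * N / s)"
  proof (rule mult_right_mono)
    show "(\<Sum>i<n. \<Sum>k<n. (G i k)\<^sup>2) \<le> N"
      unfolding N(1) using row by (intro sum_mono) auto
  qed (use s N in simp)
  also have "\<dots> = 2 * N\<^sup>2 / s"
    by (simp add: power2_eq_square)
  finally have "(\<Sum>i<n. V i i / p i) \<le> 2 * N\<^sup>2 / s" .
  \<comment> \<open>The 5 is 3 from the tripled double sum plus 2 from the diagonal
    correction.\<close>
  with off show ?thesis
    by (simp add: add_divide_distrib)
qed

section \<open>Sparsity and entry bounds\<close>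

lemma nnz_mat_eq_sum:
  assumes A: "A \<in> carrier_mat n n"
  shows "nnz_mat A = (\<Sum>i<n. nnz_vec (Matrix.row A i))"
proof -
  have "{(i, j). i < dim_row A \<and> j < dim_col A \<and> A $$ (i, j) \<noteq> 0}
      = Sigma {..<n} (\<lambda>i. {j. j < n \<and> A $$ (i, j) \<noteq> 0})"
    using A by auto
  moreover have "{j. j < dim_vec (Matrix.row A i) \<and> Matrix.row A i $ j \<noteq> 0}
      = {j. j < n \<and> A $$ (i, j) \<noteq> 0}" if "i < n" for i
    using A that by auto
  ultimately show ?thesis
    unfolding nnz_mat_def nnz_vec_def by simp
qed

lemma nnz_row_eq:
  assumes "A \<in> carrier_mat n n" "i < n"
  shows "nnz_vec (Matrix.row A i) = card {j. j < n \<and> A $$ (i, j) \<noteq> 0}"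
  unfolding nnz_vec_def using assms by (intro arg_cong[of _ _ card]) auto

lemma nnz_row_pos:
  assumes A: "A \<in> carrier_mat n n" "i < n" and nz: "Matrix.row A i \<noteq> 0\<^sub>v n"
  shows "0 < nnz_vec (Matrix.row A i)"
proof -
  have "\<exists>j<n. A $$ (i, j) \<noteq> 0"
  proof (rule ccontr)
    assume "\<not> ?thesis"
    then have "Matrix.row A i = 0\<^sub>v n"
      using A by (intro eq_vecI) auto
    then show False using nz by simp
  qed
  then show ?thesis
    unfolding nnz_row_eq[OF A] by (auto simp: card_gt_0_iff)
qed

lemma abs_entry_le_max_norm:
  assumes "A \<in> carrier_mat n m" "i < n" "j < m"
  shows "\<bar>A $$ (i, j)\<bar> \<le> max_norm_mat A"
proof -
  have "elements_mat A = (\<lambda>(i, j). A $$ (i, j)) ` ({..<dim_row A} \<times> {..<dim_col A})"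
    unfolding elements_mat_def by force
  moreover from this have "A $$ (i, j) \<in> elements_mat A"
    using assms by (auto intro!: image_eqI[of _ _ "(i, j)"])
  ultimately show ?thesis
    unfolding max_norm_mat_def by (intro Max_ge) simp_all
qed

text \<open>Thresholding commutes with sampling, as its condition depends only on row sparsities of
  the full matrix. The procedure's matrix is thus the compression of one fixed matrix
  \<open>G\<close>, independent of \<open>S\<close>.\<close>

lemma sparsified_submatrix_eq_sampled_mat:
  assumes A: "A \<in> carrier_mat n n" and S: "S \<subseteq> {..<n}"
  shows "sparsified_submatrix c2 \<epsilon> s A S
    = sampled_mat (thresholded (\<epsilon>\<^sup>2 * real (nnz_mat A) / (c2 * (trunc_ln (real n))\<^sup>2))
        (\<lambda>i. real (nnz_vec (Matrix.row A i))) A) (sample_prob s A) S"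
proof (rule eq_matI)
  fix a b assume "a < dim_row (sampled_mat (thresholded (\<epsilon>\<^sup>2 * real (nnz_mat A) / (c2 * (trunc_ln (real n))\<^sup>2))
        (\<lambda>i. real (nnz_vec (Matrix.row A i))) A) (sample_prob s A) S)"
    "b < dim_col (sampled_mat (thresholded (\<epsilon>\<^sup>2 * real (nnz_mat A) / (c2 * (trunc_ln (real n))\<^sup>2))
        (\<lambda>i. real (nnz_vec (Matrix.row A i))) A) (sample_prob s A) S)"
  then have ab: "a < card S" "b < card S" by (auto simp: sampled_mat_def)
  then have pick_lt: "pick S a < n" "pick S b < n"
    using pick_in_set_le[of a S] pick_in_set_le[of b S] S by auto
  have "{i. i < n \<and> i \<in> S} = S" using S by auto
  then have "submatrix A S S $$ (a, b) = A $$ (pick S a, pick S b)"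
    using ab A by (intro submatrix_index) auto
  then show "sparsified_submatrix c2 \<epsilon> s A S $$ (a, b)
    = sampled_mat (thresholded (\<epsilon>\<^sup>2 * real (nnz_mat A) / (c2 * (trunc_ln (real n))\<^sup>2))
        (\<lambda>i. real (nnz_vec (Matrix.row A i))) A) (sample_prob s A) S $$ (a, b)"
    using ab A pick_lt
    by (auto simp: sparsified_submatrix_def sampled_mat_def thresholded_def Let_def)
qed (auto simp: sparsified_submatrix_def sampled_mat_def)

section \<open>Choice of constants\<close>

text \<open>The constant \<open>50000\<close> exceeds \<open>5 * 96\<^sup>2\<close>, where \<open>5\<close> is from the variance bound and
  \<open>96 = 6 * 4\<^sup>2\<close> from \<open>6 * \<beta> \<le> \<theta>\<^sup>2\<close> with \<open>\<theta> = \<epsilon> * sqrt N / 4\<close>.\<close>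

lemma sample_size_consequences:
  fixes L \<epsilon> \<delta> c c2 s :: real
  assumes "1 \<le> L" and \<epsilon>: "0 < \<epsilon>" "\<epsilon> < 1" and \<delta>: "0 < \<delta>" "\<delta> < 1" and "c = 50000 + \<bar>c2\<bar>"
    and s: "c * L ^ 8 / (\<epsilon> ^ 8 * \<delta> ^ 4) \<le> s"
  shows "50000 \<le> s * (\<epsilon> ^ 4 * \<delta>)" "16 \<le> s * \<epsilon>\<^sup>2" "c2 * L\<^sup>2 \<le> s * \<epsilon>\<^sup>2"
proof -
  have L: "1 \<le> L ^ 8" "L\<^sup>2 \<le> L ^ 8"
    using assms(1) by (auto intro: one_le_power power_increasing)
  have c: "50000 \<le> c" "c2 \<le> c" "0 \<le> c"
    using assms(6) by auto
  \<comment> \<open>As \<open>\<epsilon>\<close> and \<open>\<delta>\<close> are below 1, lowering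
    their exponents increases the product. The scale \<open>\<epsilon> ^ 4 * \<delta>\<close> serves
    Markov's inequality, the scale \<open>\<epsilon>\<^sup>2\<close> the threshold and the
    diagonal.\<close>
  have ed: "\<epsilon> ^ 8 * \<delta> ^ 4 \<le> \<epsilon> ^ 4 * \<delta>" "\<epsilon> ^ 8 * \<delta> ^ 4 \<le> \<epsilon>\<^sup>2"
  proof -
    have "\<epsilon> ^ 8 \<le> \<epsilon> ^ 4" "\<epsilon> ^ 8 \<le> \<epsilon>\<^sup>2"
      using \<epsilon> by (auto intro: power_decreasing)
    moreover have "\<delta> ^ 4 \<le> \<delta> ^ 1" "\<delta> ^ 4 \<le> 1"
      using \<delta> power_decreasing[of 1 4 \<delta>] by (auto intro: power_le_one)
    ultimately have "\<epsilon> ^ 8 * \<delta> ^ 4 \<le> \<epsilon> ^ 4 * \<delta> ^ 1" "\<epsilon> ^ 8 * \<delta> ^ 4 \<le> \<epsilon>\<^sup>2 * 1"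
      using \<epsilon> \<delta> mult_mono[of "\<epsilon> ^ 8" "\<epsilon> ^ 4" "\<delta> ^ 4" "\<delta> ^ 1"]
        mult_mono[of "\<epsilon> ^ 8" "\<epsilon>\<^sup>2" "\<delta> ^ 4" 1] by auto
    then show "\<epsilon> ^ 8 * \<delta> ^ 4 \<le> \<epsilon> ^ 4 * \<delta>" "\<epsilon> ^ 8 * \<delta> ^ 4 \<le> \<epsilon>\<^sup>2" by auto
  qed
  have pos: "0 < \<epsilon> ^ 8 * \<delta> ^ 4" using \<epsilon> \<delta> by simp
  have "c * L ^ 8 \<le> s * (\<epsilon> ^ 8 * \<delta> ^ 4)"
    using s pos by (simp add: pos_divide_le_eq)
  moreover have "0 \<le> s"
    using s c L pos by (meson divide_nonneg_pos mult_nonneg_nonneg order_trans zero_le_one)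
  ultimately have cL: "c * L ^ 8 \<le> s * X" if "\<epsilon> ^ 8 * \<delta> ^ 4 \<le> X" for X
    using mult_left_mono[OF that, of s] by linarith
  have cc: "c \<le> c * L ^ 8"
    using mult_left_mono[OF L(1) c(3)] by simp
  show "50000 \<le> s * (\<epsilon> ^ 4 * \<delta>)" "16 \<le> s * \<epsilon>\<^sup>2"
    using cL[OF ed(1)] cL[OF ed(2)] cc c by linarith+
  have "c2 * L\<^sup>2 \<le> c * L\<^sup>2"
    using c by (intro mult_right_mono) auto
  also have "\<dots> \<le> c * L ^ 8"
    using L c by (intro mult_left_mono) auto
  finally show "c2 * L\<^sup>2 \<le> s * \<epsilon>\<^sup>2"
    using cL[OF ed(2)] by linarith
qed

text \<open>The allowed error \<open>\<epsilon> * sqrt N\<close> is \<open>4 * \<theta>\<close>: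
  half pays for sampling through \<open>merged_spectrum_error\<close>, half for the discarded
  entries through \<open>1 + sqrt \<tau>\<close>. Markov's inequality for
  \<open>total_deviation\<close> at level \<open>\<beta>\<^sup>2\<close> gives the failure
  probability \<open>\<delta>\<close>.\<close>

lemma sampled_eigenvalues_close:
  fixes A :: "real mat" and c2 \<epsilon> \<delta> s :: real
  assumes c2: "16 \<le> c2" and c: "c = 50000 + \<bar>c2\<bar>" and \<epsilon>: "0 < \<epsilon>" "\<epsilon> < 1" and \<delta>: "0 < \<delta>" "\<delta> < 1"
    and A: "A \<in> carrier_mat n n" "A\<^sup>T = A" and A1: "max_norm_mat A \<le> 1"
    and rows: "\<And>i. i < n \<Longrightarrow> Matrix.row A i \<noteq> 0\<^sub>v n"
    and N_ge: "c * (trunc_ln (real n)) ^ 8 / (\<epsilon> ^ 8 * \<delta> ^ 4) \<le> real (nnz_mat A)"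
    and s_pos: "0 < s" and s_ge: "c * (trunc_ln (real n)) ^ 8 / (\<epsilon> ^ 8 * \<delta> ^ 4) \<le> s"
  shows "1 - \<delta> \<le> measure_pmf.prob (random_subset n (sample_prob s A))
      {S. \<forall>i\<in>{1..n}.
            \<bar>eigval_estimate c2 \<epsilon> s A S i - eigval A i\<bar> \<le> \<epsilon> * sqrt (real (nnz_mat A))}"
proof -
  define L where "L = trunc_ln (real n)"
  define N where "N = real (nnz_mat A)"
  define d where "d i = real (nnz_vec (Matrix.row A i))" for i
  define p where "p = sample_prob s A"
  define \<tau> where "\<tau> = \<epsilon>\<^sup>2 * N / (c2 * L\<^sup>2)"
  define G where "G = thresholded \<tau> d A"
  define \<theta> where "\<theta> = \<epsilon> * sqrt N / 4"
  define \<beta> where "\<beta> = \<epsilon>\<^sup>2 * N / 96"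
  have L: "1 \<le> L" by (simp add: L_def trunc_ln_def)
  note Nb = sample_size_consequences[OF L \<epsilon> \<delta> c N_ge[folded L_def N_def]]
  note sb = sample_size_consequences[OF L \<epsilon> \<delta> c s_ge[folded L_def]]
  have Npos: "0 < N"
  proof -
    have "0 < N * \<epsilon>\<^sup>2" using Nb(2) by linarith
    then show ?thesis using \<epsilon> by (simp add: zero_less_mult_iff)
  qed
  have d1: "1 \<le> d i" if "i < n" for i
    using nnz_row_pos[OF A(1) that rows[OF that]] by (simp add: d_def)
  have Nsum: "N = (\<Sum>i<n. d i)"
    unfolding N_def d_def nnz_mat_eq_sum[OF A(1)] by simp
  have p_eq: "p i = min 1 (s * d i / N)" for i
    by (simp add: p_def sample_prob_def d_def N_def)
  have p: "\<forall>i<n. 0 < p i \<and> p i \<le> 1"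
    using p_eq d1 s_pos Npos by (smt (verit) divide_pos_pos mult_pos_pos)
  have le1: "\<bar>A $$ (i, j)\<bar> \<le> 1" if "i < n" "j < n" for i j
    using abs_entry_le_max_norm[OF A(1) that] A1 by linarith
  have Gsym: "G i j = G j i" for i j
  proof (cases "max i j < n")
    case True
    then have "A $$ (i, j) = A $$ (j, i)"
      using A by (metis carrier_matD index_transpose_mat(1) max_less_iff_conj)
    then show ?thesis
      by (auto simp: G_def thresholded_def mult.commute max.commute)
  next
    case False
    then show ?thesis
      using A(1) by (auto simp: G_def thresholded_def max.commute)
  qed
  have G0: "G i i = 0" for i
    by (simp add: G_def thresholded_def)
  have G1: "(G i j)\<^sup>2 \<le> 1" if "i < n" "j < n" for i j
    using le1[OF that] by (auto simp: G_def thresholded_def abs_square_le_1)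
  have nnz: "real (card {j. j < n \<and> A $$ (i, j) \<noteq> 0}) = d i" if "i < n" for i
    unfolding d_def nnz_row_eq[OF A(1) that] ..
  have row: "(\<Sum>j<n. (G i j)\<^sup>2) \<le> d i" if "i < n" for i
  proof -
    have "(\<Sum>j<n. (G i j)\<^sup>2) = (\<Sum>j | j < n \<and> A $$ (i, j) \<noteq> 0. (G i j)\<^sup>2)"
      by (intro sum.mono_neutral_right) (auto simp: G_def thresholded_def)
    also have "\<dots> \<le> (\<Sum>j | j < n \<and> A $$ (i, j) \<noteq> 0. 1)"
      using G1[OF that] by (intro sum_mono) auto
    finally show ?thesis using nnz[OF that] by simp
  qed
  have thr: "\<tau> \<le> d i * d j" if "G i j \<noteq> 0" for i j
    using that by (auto simp: G_def thresholded_def split: if_splits)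
  have \<tau>: "0 < \<tau>" "N \<le> s * \<tau>" "\<tau> \<le> \<epsilon>\<^sup>2 * N / 16"
  proof -
    have cL: "0 < c2 * L\<^sup>2" "16 \<le> c2 * L\<^sup>2"
      using c2 L mult_mono[of 16 c2 1 "L\<^sup>2"] one_le_power[OF L, of 2] by auto
    show "0 < \<tau>" unfolding \<tau>_def using cL \<epsilon> Npos by simp
    \<comment> \<open>A rescaling of \<open>c2 * L\<^sup>2 \<le> s * \<epsilon>\<^sup>2\<close>, for
      which \<open>c\<close> includes \<open>\<bar>c2\<bar>\<close>.\<close>
    have "N * (c2 * L\<^sup>2) \<le> N * (s * \<epsilon>\<^sup>2)"
      using sb(3) Npos by (intro mult_left_mono) auto
    then show "N \<le> s * \<tau>"
      unfolding \<tau>_def using cL(1) by (simp add: pos_le_divide_eq mult.commute mult.left_commute)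
    show "\<tau> \<le> \<epsilon>\<^sup>2 * N / 16"
      unfolding \<tau>_def using cL Npos by (intro divide_left_mono) auto
  qed
  have sqrt_N: "(sqrt N)\<^sup>2 = N" using Npos by simp
  have \<theta>: "0 < \<theta>" "6 * \<beta> \<le> \<theta>\<^sup>2" and \<beta>: "0 < \<beta>"
    using \<epsilon> Npos by (auto simp: \<theta>_def \<beta>_def power_mult_distrib power_divide sqrt_N)
  \<comment> \<open>Each summand is at most \<open>\<theta>\<close>: \<open>sqrt \<tau>\<close>
    because \<open>c2 * L\<^sup>2 \<ge> 16\<close>, and 1 because the lower bound on
    \<open>N\<close> gives \<open>N * \<epsilon>\<^sup>2 \<ge> 16\<close>.\<close>
  have e_le: "1 + sqrt \<tau> \<le> 2 * \<theta>"
  proof -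
    have "sqrt \<tau> \<le> sqrt ((\<epsilon> * sqrt N / 4)\<^sup>2)"
      using \<tau>(3) by (simp add: power_mult_distrib power_divide sqrt_N)
    then have "sqrt \<tau> \<le> \<epsilon> * sqrt N / 4"
      using \<epsilon> Npos by simp
    moreover have "1 \<le> \<epsilon> * sqrt N / 4"
    proof (rule power2_le_imp_le)
      show "1\<^sup>2 \<le> (\<epsilon> * sqrt N / 4)\<^sup>2"
        using Nb(2) by (simp add: power_mult_distrib power_divide sqrt_N mult.commute)
    qed (use \<epsilon> Npos in simp)
    ultimately show ?thesis by (simp add: \<theta>_def)
  qed
  have "measure_pmf.expectation (random_subset n p) (total_deviation n G p) \<le> 5 * N\<^sup>2 / s"
    by (rule order_trans[OF expectation_total_deviation_le[OF p G0]
          deviation_variance_bound[OF d1 Nsum Npos s_pos Gsym G1 row thr \<tau>(1,2) p_eq]])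
  also have "\<dots> \<le> \<delta> * \<beta>\<^sup>2"
  proof -
    have "50000 * N\<^sup>2 \<le> s * (\<epsilon> ^ 4 * \<delta>) * N\<^sup>2"
      using sb(1) by (intro mult_right_mono) auto
    moreover have "s * (\<delta> * \<beta>\<^sup>2) = s * (\<epsilon> ^ 4 * \<delta>) * N\<^sup>2 / 9216"
      by (simp add: \<beta>_def power_mult_distrib power_divide)
    ultimately have "5 * N\<^sup>2 \<le> s * (\<delta> * \<beta>\<^sup>2)"
      using zero_le_power2[of N] by linarith
    then show ?thesis
      using s_pos by (simp add: pos_divide_le_eq mult.commute)
  qed
  finally have E: "measure_pmf.expectation (random_subset n p) (total_deviation n G p) \<le> \<delta> * \<beta>\<^sup>2" .
  have good: "\<bar>eigval_estimate c2 \<epsilon> s A S j - eigval A j\<bar> \<le> \<epsilon> * sqrt N"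
    if S: "S \<subseteq> {..<n}" and dev: "total_deviation n G p S < \<beta>\<^sup>2" and j: "1 \<le> j" "j \<le> n" for S j
  proof -
    let ?M = "sampled_mat G p S" and ?K = "compression_mat n G p S" and ?G = "full_mat n G"
    have M: "sparsified_submatrix c2 \<epsilon> s A S = ?M"
      unfolding sparsified_submatrix_eq_sampled_mat[OF A(1) S] G_def \<tau>_def d_def N_def L_def p_def ..
    have carr: "?M \<in> carrier_mat (card S) (card S)" "?K \<in> carrier_mat n (card S)" "?G \<in> carrier_mat n n"
      by (auto simp: sampled_mat_def compression_mat_def full_mat_def)
    have sym: "?M\<^sup>T = ?M" "?G\<^sup>T = ?G"
      using Gsym by (auto intro!: eq_matI simp: sampled_mat_def full_mat_def mult.commute)
    have kn: "card S \<le> n"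
      using card_mono[OF _ S] by simp
    have fro: "frobenius_sq (?K\<^sup>T * ?K - ?M * ?M) \<le> \<beta>\<^sup>2" "frobenius_sq (?K * ?K\<^sup>T - ?G * ?G) \<le> \<beta>\<^sup>2"
      "frobenius_sq (?G * ?K - ?K * ?M) \<le> \<beta>\<^sup>2"
      using frobenius_inner[where G = G, OF S Gsym p] frobenius_outer[where G = G, OF S Gsym p]
        frobenius_intertwining[where G = G, OF S Gsym p] dev by linarith+
    have diff: "\<bar>x \<bullet> (A *\<^sub>v x) - x \<bullet> (?G *\<^sub>v x)\<bar> \<le> (1 + sqrt \<tau>) * (x \<bullet> x)" if "x \<in> carrier_vec n" for x
      unfolding G_def
      by (rule thresholded_quadratic_form[OF A le1 _ _ _ that]) (use d1 nnz \<tau>(1) in \<open>force+\<close>)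
    have "\<bar>eigval_estimate c2 \<epsilon> s A S j - eigval A j\<bar> \<le> 2 * \<theta> + (1 + sqrt \<tau>)"
      unfolding eigval_estimate_def Let_def M carrier_matD(1)[OF A(1)]
      by (rule merged_spectrum_error[OF A carr(3) sym(2) carr(1) sym(1) carr(2) kn fro
            less_imp_le[OF \<beta>] \<theta>(2,1) diff j])
    also have "\<dots> \<le> \<epsilon> * sqrt N"
      using e_le by (simp add: \<theta>_def)
    finally show ?thesis .
  qed
  show ?thesis
    unfolding p_def[symmetric] N_def[symmetric]
  proof (rule prob_random_subset_ge_of_expectation[OF _ E])
    show "0 \<le> total_deviation n G p S" for S
      unfolding total_deviation_def
    proof (intro sum_nonneg mult_nonneg_nonneg)
      fix i j assume "i \<in> {..<n}" "j \<in> {..<n}"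
      then show "0 \<le> 1 + sample_weight p S j + sample_weight p S i * sample_weight p S j"
        using p by (auto simp: sample_weight_def less_imp_le)
    qed simp
    show "0 < \<beta>\<^sup>2" using \<beta> by simp
  qed (use good in auto)
qed

theorem theorem2:
  shows "\<exists>C0::real. \<forall>c2\<ge>C0. \<exists>c>0. \<forall>(n::nat) (\<epsilon>::real) (\<delta>::real) (s::real) (A::real mat).
    0 < \<epsilon> \<and> \<epsilon> < 1 \<and> 0 < \<delta> \<and> \<delta> < 1 \<and>
    A \<in> carrier_mat n n \<and> transpose_mat A = A \<and>
    max_norm_mat A \<le> 1 \<and>
    (\<forall>i<n. Matrix.row A i \<noteq> 0\<^sub>v n) \<and>
    real (nnz_mat A) \<ge> c * (trunc_ln (real n)) ^ 8 / (\<epsilon> ^ 8 * \<delta> ^ 4) \<and>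
    s > 0 \<and>
    s \<ge> c * (trunc_ln (real n)) ^ 8 / (\<epsilon> ^ 8 * \<delta> ^ 4)
    \<longrightarrow>
    measure_pmf.prob (random_subset n (sample_prob s A))
      {S. \<forall>i\<in>{1..n}.
            \<bar>eigval_estimate c2 \<epsilon> s A S i - eigval A i\<bar> \<le> \<epsilon> * sqrt (real (nnz_mat A))}
      \<ge> 1 - \<delta>"
proof (rule exI[of _ 16], intro allI impI)
  \<comment> \<open>The threshold 16 makes \<open>\<tau> \<le> \<epsilon>\<^sup>2 * N / 16\<close>,
    so that the light entries cost at most \<open>\<epsilon> * sqrt N / 4\<close>.\<close>
  fix c2 :: real assume c2: "16 \<le> c2"
  show "\<exists>c>0. \<forall>(n::nat) (\<epsilon>::real) (\<delta>::real) (s::real) (A::real mat).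
    0 < \<epsilon> \<and> \<epsilon> < 1 \<and> 0 < \<delta> \<and> \<delta> < 1 \<and>
    A \<in> carrier_mat n n \<and> transpose_mat A = A \<and>
    max_norm_mat A \<le> 1 \<and>
    (\<forall>i<n. Matrix.row A i \<noteq> 0\<^sub>v n) \<and>
    real (nnz_mat A) \<ge> c * (trunc_ln (real n)) ^ 8 / (\<epsilon> ^ 8 * \<delta> ^ 4) \<and>
    s > 0 \<and>
    s \<ge> c * (trunc_ln (real n)) ^ 8 / (\<epsilon> ^ 8 * \<delta> ^ 4)
    \<longrightarrow>
    measure_pmf.prob (random_subset n (sample_prob s A))
      {S. \<forall>i\<in>{1..n}.
            \<bar>eigval_estimate c2 \<epsilon> s A S i - eigval A i\<bar> \<le> \<epsilon> * sqrt (real (nnz_mat A))}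
      \<ge> 1 - \<delta>"
    by (intro exI[of _ "50000 + \<bar>c2\<bar>"] conjI allI impI,
        simp, elim conjE, rule sampled_eigenvalues_close[OF c2 refl]) auto
qed

end
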